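(* Given a finite scenario set $S$ and a set $\mathcal{C}$ of permissible event sets, the SNAC algorithm (described in the context) terminates with a set $\mathcal{N}$ of edges (unordered pairs of distinct scenarios) that corresponds to a set of non-anticipativity constraints enforced on the minimum number of pairs of scenarios; that is, the constraints given by $\mathcal{N}$ are sufficient to enforce non-anticipativity, and $|\mathcal{N}| \le |\mathcal{N}'|$ for every set $\mathcal{N}'$ of unordered pairs of distinct scenarios whose constraints are sufficient to enforce non-anticipativity. Moreover, the algorithm can be implemented in a way that guarantees that its running time grows as $O(|\mathcal{C}|\,|S|^3)$ as $|\mathcal{C}|, |S| \to +\infty$.
   Context: $S$ is a finite set of scenarios, a subset of the Cartesian product of the finite sets of possible realizations of all uncertain parameters of a multistage stochastic program. It need not be the full product. Information about uncertain parameters is revealed gradually through the occurrence of events from a finite set of events. $\mathcal{C}$ is a given set of subsets of the set of events, called the permissible event sets (the combinations of events that may have occurred at some state of the system). For scenarios $r,s \in S$, $\Psi(r,s)$ denotes the set of differentiating events for $r$ and $s$, i.e. the events whose occurrence makes $r$ and $s$ distinguishable. Scenarios $r$ and $s$ are indistinguishable under $c \in \mathcal{C}$ if $c \cap \Psi(r,s) = \emptyset$. For each $c \in \mathcal{C}$, this is an equivalence relation on $S$, and $\Pi(c): S = \bigcup_j S_j^c$ denotes the corresponding partition of $S$ into equivalence classes. Decisions may depend on the scenario $s$ and on the set $c$ of realized events; write $x_{s,c}$ for the (vector of) decisions taken under scenario $s$ when the realized event set is $c$. The non-anticipativity constraint (NAC) for a pair $\{r,s\}$ requires $x_{r,c}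 = x_{s,c}$ for every $c \in \mathcal{C}$ under which $r$ and $s$ are indistinguishable, and requires nothing for other $c$. Non-anticipativity means that the NAC holds for all pairs of distinct scenarios in $S$. The constraints given by a set $\mathcal{N}$ of unordered pairs of distinct scenarios are sufficient to enforce non-anticipativity if every assignment of decision values $(x_{s,c})_{s \in S, c \in \mathcal{C}}$ (with values in a set having at least two elements, no other constraints of the model being taken into account) that satisfies the NAC for every pair in $\mathcal{N}$ satisfies the NAC for all pairs of distinct scenarios. The Sample Non-Anticipativity Constraint (SNAC) algorithm: 1. Set $k := \max\{|c| : c \in \mathcal{C}\}$ and $\mathcal{N} := \emptyset$. 2. While $k \ge 0$: for each $c \in \mathcal{C}$ with $|c| = k$, generate the sets $S_j^c \in \Pi(c)$; for each $S_j^c$, take the graph with vertex set $S_j^c$ and those existing edges of $\mathcal{N}$ having both endpoints in $S_j^c$, treat each of its connected components as a single node, and construct a spanning tree on these nodes (i.e. choose a set of new edges with both endpoints in $S_j^c$, one fewer than the number of components, making the graph on $S_j^c$ connected); add the chosen edges to $\mathcal{N}$. Then set $k := k-1$. 3. Output $\mathcal{N}$. The choice of spanning trees is arbitrary. The sets $S_j^c$ with $|c| = k$ for the same $k$ are treated in parallel, i.e. the spanning trees for them are constructed without regard to edges added at the same iteration $k$. Running time is measured in elementary operations, where deciding whether two given scenarios are indistinguishable under a given $c \in \mathcal{C}$ counts as one elementary operation.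
   Formalization: That every output is minimum is proved only if any two scenarios indistinguishable under two permissible event sets are so under a permissible superset of both; otherwise it can fail (S={1,2,3}, C={{a},{b}}, a, b differentiating nothing), and only some choice of trees is shown to give a minimum. *)

theory Defs
  imports "HOL-Library.Landau_Symbols"
begin

section \<open>Scenarios, permissible event sets, non-anticipativity\<close>

definition indist :: "('s \<Rightarrow> 's \<Rightarrow> 'e set) \<Rightarrow> 'e set \<Rightarrow> 's \<Rightarrow> 's \<Rightarrow> bool" where
  "indist \<Psi> c r s \<longleftrightarrow> c \<inter> \<Psi> r s = {}"

definition indist_rel :: "'s set \<Rightarrow> ('s \<Rightarrow> 's \<Rightarrow> 'e set) \<Rightarrow> 'e set \<Rightarrow> ('s \<times> 's) set" where
  "indist_rel S \<Psi> c = {(r, s). r \<in> S \<and> s \<in> S \<and> indist \<Psi> c r s}"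

definition Pi_partition :: "'s set \<Rightarrow> ('s \<Rightarrow> 's \<Rightarrow> 'e set) \<Rightarrow> 'e set \<Rightarrow> 's set set" where
  "Pi_partition S \<Psi> c = S // indist_rel S \<Psi> c"

definition scenario_model ::
  "'e set \<Rightarrow> 's set \<Rightarrow> 'e set set \<Rightarrow> ('s \<Rightarrow> 's \<Rightarrow> 'e set) \<Rightarrow> bool" where
  "scenario_model E S C \<Psi> \<longleftrightarrow>
     finite E \<and> finite S \<and> C \<subseteq> Pow E \<and> (\<forall>r\<in>S. \<forall>s\<in>S. \<Psi> r s \<subseteq> E) \<and>
     (\<forall>c\<in>C. equiv S (indist_rel S \<Psi> c))"

definition pairs :: "'s set \<Rightarrow> 's set set" where
  "pairs X = {{r, s} | r s. r \<in> X \<and> s \<in> X \<and> r \<noteq> s}"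

definition nac ::
  "'e set set \<Rightarrow> ('s \<Rightarrow> 's \<Rightarrow> 'e set) \<Rightarrow> ('s \<Rightarrow> 'e set \<Rightarrow> 'v) \<Rightarrow> 's \<Rightarrow> 's \<Rightarrow> bool" where
  "nac C \<Psi> x r s \<longleftrightarrow> (\<forall>c\<in>C. indist \<Psi> c r s \<longrightarrow> x r c = x s c)"

definition sufficient ::
  "'v set \<Rightarrow> 's set \<Rightarrow> 'e set set \<Rightarrow> ('s \<Rightarrow> 's \<Rightarrow> 'e set) \<Rightarrow> 's set set \<Rightarrow> bool" where
  "sufficient V S C \<Psi> N \<longleftrightarrow>
     N \<subseteq> pairs S \<and>
     (\<forall>x. (\<forall>s\<in>S. \<forall>c\<in>C. x s c \<in> V) \<and> (\<forall>r s. {r, s} \<in> N \<longrightarrow> nac C \<Psi> x r s) \<longrightarrow>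
          (\<forall>r\<in>S. \<forall>s\<in>S. r \<noteq> s \<longrightarrow> nac C \<Psi> x r s))"

definition minimum_sufficient ::
  "'v set \<Rightarrow> 's set \<Rightarrow> 'e set set \<Rightarrow> ('s \<Rightarrow> 's \<Rightarrow> 'e set) \<Rightarrow> 's set set \<Rightarrow> bool" where
  "minimum_sufficient V S C \<Psi> N \<longleftrightarrow>
     sufficient V S C \<Psi> N \<and> (\<forall>N'. sufficient V S C \<Psi> N' \<longrightarrow> card N \<le> card N')"

text \<open>
  Two scenarios that are indistinguishable under two permissible event sets are also
  indistinguishable under a common permissible superset. This holds in particular whenever
  \<open>C\<close> is closed under binary unions (for instance if \<open>C = Pow E\<close>, or if an event that can
  occur can still occur after any other permissible combination of events). Without it, the
  trees chosen in parallel for event sets of equal size may overlap wastefully: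
  if \<open>S = {1, 2, 3}\<close>, \<open>C = {{a}, {b}}\<close> and no event of \<open>C\<close> differentiates anything, then the
  trees 1-2-3 and 2-1-3 give three pairs although two suffice.
\<close>
definition jointly_permissible ::
  "'s set \<Rightarrow> 'e set set \<Rightarrow> ('s \<Rightarrow> 's \<Rightarrow> 'e set) \<Rightarrow> bool" where
  "jointly_permissible S C \<Psi> \<longleftrightarrow>
     (\<forall>r\<in>S. \<forall>s\<in>S. r \<noteq> s \<longrightarrow>
        (\<forall>c\<in>C. \<forall>d\<in>C. indist \<Psi> c r s \<and> indist \<Psi> d r s \<longrightarrow>
           (\<exists>b\<in>C. c \<union> d \<subseteq> b \<and> indist \<Psi> b r s)))"


section \<open>The SNAC algorithm\<close>

definition reach_rel :: "'s set \<Rightarrow> 's set set \<Rightarrow> ('s \<times> 's) set" where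
  "reach_rel X N =
     {(r, s). r \<in> X \<and> s \<in> X \<and> (r, s) \<in> {(u, v). u \<in> X \<and> v \<in> X \<and> {u, v} \<in> N}\<^sup>*}"

definition components :: "'s set \<Rightarrow> 's set set \<Rightarrow> 's set set" where
  "components X N = X // reach_rel X N"

definition connected_graph :: "'s set \<Rightarrow> 's set set \<Rightarrow> bool" where
  "connected_graph X N \<longleftrightarrow> (\<forall>r\<in>X. \<forall>s\<in>X. (r, s) \<in> reach_rel X N)"

definition component_tree :: "'s set \<Rightarrow> 's set set \<Rightarrow> 's set set \<Rightarrow> bool" where
  "component_tree X N T \<longleftrightarrow>
     T \<subseteq> pairs X \<and> T \<inter> N = {} \<and> card T + 1 = card (components X N) \<and>
     connected_graph X (N \<union> T)"

text \<open>
  A configuration is a pair of the counter \<open>k\<close> and the current set of pairs. All trees of one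
  iteration refer to the set \<open>N\<close> at its beginning.
\<close>
inductive snac_step ::
  "'s set \<Rightarrow> 'e set set \<Rightarrow> ('s \<Rightarrow> 's \<Rightarrow> 'e set) \<Rightarrow>
   int \<times> 's set set \<Rightarrow> int \<times> 's set set \<Rightarrow> bool"
  for S C \<Psi> where
  "\<lbrakk> k \<ge> 0;
     \<forall>c\<in>C. int (card c) = k \<longrightarrow> (\<forall>X\<in>Pi_partition S \<Psi> c. component_tree X N (T c X));
     N' = N \<union> (\<Union>c\<in>{c\<in>C. int (card c) = k}. \<Union>X\<in>Pi_partition S \<Psi> c. T c X) \<rbrakk>
   \<Longrightarrow> snac_step S C \<Psi> (k, N) (k - 1, N')"

definition snac_init :: "'e set set \<Rightarrow> int \<times> 's set set" where
  "snac_init C = (int (Max (card ` C)), {})"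

definition snac_output ::
  "'s set \<Rightarrow> 'e set set \<Rightarrow> ('s \<Rightarrow> 's \<Rightarrow> 'e set) \<Rightarrow> 's set set \<Rightarrow> bool" where
  "snac_output S C \<Psi> N \<longleftrightarrow> (\<exists>k<0. (snac_step S C \<Psi>)\<^sup>*\<^sup>* (snac_init C) (k, N))"

text \<open>
  Every run is finite, and no run gets stuck before the loop condition fails (the required
  spanning trees always exist).
\<close>
definition snac_terminates ::
  "'s set \<Rightarrow> 'e set set \<Rightarrow> ('s \<Rightarrow> 's \<Rightarrow> 'e set) \<Rightarrow> bool" where
  "snac_terminates S C \<Psi> \<longleftrightarrow>
     (\<nexists>f :: nat \<Rightarrow> int \<times> 's set set.
        f 0 = snac_init C \<and> (\<forall>i. snac_step S C \<Psi> (f i) (f (Suc i)))) \<and>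
     (\<forall>k N. (snac_step S C \<Psi>)\<^sup>*\<^sup>* (snac_init C) (k, N) \<and> k \<ge> 0 \<longrightarrow>
        (\<exists>y. snac_step S C \<Psi> (k, N) y))"


section \<open>A random access machine for implementations\<close>

text \<open>
  Memory consists of countably many two-dimensional arrays of natural numbers, initially zero
  (a scalar is a cell such as \<open>(a, 0, 0)\<close>). The input, given as enumerations \<open>ss\<close> of the
  scenarios and \<open>cs\<close> of the permissible event sets in arbitrary order, is accessed only by
  position: through the numbers of scenarios and of event sets, the cardinality of an event set,
  and the test whether two scenarios are indistinguishable under an event set. Truth values are
  \<open>0\<close> and \<open>1\<close>. Each syntactic node that is evaluated costs one unit.
\<close>

type_synonym store = "nat \<Rightarrow> nat \<Rightarrow> nat \<Rightarrow> nat"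

datatype expr =
    Num nat
  | NumScenarios
  | NumEventSets
  | EventSetSize expr
  | Indist expr expr expr
  | Read nat expr expr
  | Plus expr expr
  | Minus expr expr
  | Less expr expr
  | Equal expr expr

fun val ::
  "'s list \<Rightarrow> 'e set list \<Rightarrow> ('s \<Rightarrow> 's \<Rightarrow> 'e set) \<Rightarrow> store \<Rightarrow> expr \<Rightarrow> nat" where
  "val ss cs \<Psi> \<sigma> (Num n) = n"
| "val ss cs \<Psi> \<sigma> NumScenarios = length ss"
| "val ss cs \<Psi> \<sigma> NumEventSets = length cs"
| "val ss cs \<Psi> \<sigma> (EventSetSize a) =
     (let i = val ss cs \<Psi> \<sigma> a in if i < length cs then card (cs ! i) else 0)"
| "val ss cs \<Psi> \<sigma> (Indist a b d) =
     (let i = val ss cs \<Psi> \<sigma> a; r = val ss cs \<Psi> \<sigma> b; s = val ss cs \<Psi> \<sigma> d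
      in of_bool (i < length cs \<and> r < length ss \<and> s < length ss \<and>
                  indist \<Psi> (cs ! i) (ss ! r) (ss ! s)))"
| "val ss cs \<Psi> \<sigma> (Read n a b) = \<sigma> n (val ss cs \<Psi> \<sigma> a) (val ss cs \<Psi> \<sigma> b)"
| "val ss cs \<Psi> \<sigma> (Plus a b) = val ss cs \<Psi> \<sigma> a + val ss cs \<Psi> \<sigma> b"
| "val ss cs \<Psi> \<sigma> (Minus a b) = val ss cs \<Psi> \<sigma> a - val ss cs \<Psi> \<sigma> b"
| "val ss cs \<Psi> \<sigma> (Less a b) = of_bool (val ss cs \<Psi> \<sigma> a < val ss cs \<Psi> \<sigma> b)"
| "val ss cs \<Psi> \<sigma> (Equal a b) = of_bool (val ss cs \<Psi> \<sigma> a = val ss cs \<Psi> \<sigma> b)"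

fun cost :: "expr \<Rightarrow> nat" where
  "cost (Num n) = 1"
| "cost NumScenarios = 1"
| "cost NumEventSets = 1"
| "cost (EventSetSize a) = 1 + cost a"
| "cost (Indist a b d) = 1 + cost a + cost b + cost d"
| "cost (Read n a b) = 1 + cost a + cost b"
| "cost (Plus a b) = 1 + cost a + cost b"
| "cost (Minus a b) = 1 + cost a + cost b"
| "cost (Less a b) = 1 + cost a + cost b"
| "cost (Equal a b) = 1 + cost a + cost b"

datatype com =
    Skip
  | Write nat expr expr expr
  | Emit expr expr
  | Seq com com
  | Cond expr com com
  | While expr com

definition upd :: "store \<Rightarrow> nat \<Rightarrow> nat \<Rightarrow> nat \<Rightarrow> nat \<Rightarrow> store" where
  "upd \<sigma> n i j v = \<sigma>(n := (\<sigma> n)(i := (\<sigma> n i)(j := v)))"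

text \<open>
  \<open>exec ss cs \<Psi> p (\<sigma>, Q) t (\<sigma>', Q')\<close>: started in memory \<open>\<sigma>\<close> with the pairs \<open>Q\<close> of scenario
  positions emitted so far, the program \<open>p\<close> halts after \<open>t\<close> units of time in memory \<open>\<sigma>'\<close> with
  the emitted pairs \<open>Q'\<close>.
\<close>
inductive exec ::
  "'s list \<Rightarrow> 'e set list \<Rightarrow> ('s \<Rightarrow> 's \<Rightarrow> 'e set) \<Rightarrow> com \<Rightarrow>
   store \<times> (nat \<times> nat) set \<Rightarrow> nat \<Rightarrow> store \<times> (nat \<times> nat) set \<Rightarrow> bool"
  for ss cs \<Psi> where
  Skip: "exec ss cs \<Psi> Skip st 1 st"
| Write: "exec ss cs \<Psi> (Write n a b d) (\<sigma>, Q) (1 + cost a + cost b + cost d)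
    (upd \<sigma> n (val ss cs \<Psi> \<sigma> a) (val ss cs \<Psi> \<sigma> b) (val ss cs \<Psi> \<sigma> d), Q)"
| Emit: "exec ss cs \<Psi> (Emit a b) (\<sigma>, Q) (1 + cost a + cost b)
    (\<sigma>, insert (val ss cs \<Psi> \<sigma> a, val ss cs \<Psi> \<sigma> b) Q)"
| Seq: "\<lbrakk> exec ss cs \<Psi> p st t st'; exec ss cs \<Psi> q st' t' st'' \<rbrakk>
    \<Longrightarrow> exec ss cs \<Psi> (Seq p q) st (1 + t + t') st''"
| CondTrue: "\<lbrakk> val ss cs \<Psi> \<sigma> a \<noteq> 0; exec ss cs \<Psi> p (\<sigma>, Q) t st' \<rbrakk>
    \<Longrightarrow> exec ss cs \<Psi> (Cond a p q) (\<sigma>, Q) (1 + cost a + t) st'"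
| CondFalse: "\<lbrakk> val ss cs \<Psi> \<sigma> a = 0; exec ss cs \<Psi> q (\<sigma>, Q) t st' \<rbrakk>
    \<Longrightarrow> exec ss cs \<Psi> (Cond a p q) (\<sigma>, Q) (1 + cost a + t) st'"
| WhileFalse: "val ss cs \<Psi> \<sigma> a = 0
    \<Longrightarrow> exec ss cs \<Psi> (While a p) (\<sigma>, Q) (1 + cost a) (\<sigma>, Q)"
| WhileTrue: "\<lbrakk> val ss cs \<Psi> \<sigma> a \<noteq> 0; exec ss cs \<Psi> p (\<sigma>, Q) t st';
      exec ss cs \<Psi> (While a p) st' t' st'' \<rbrakk>
    \<Longrightarrow> exec ss cs \<Psi> (While a p) (\<sigma>, Q) (1 + cost a + t + t') st''"

inductive_cases SkipE: "exec ss cs \<Psi> Skip st t st'"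
inductive_cases WriteE: "exec ss cs \<Psi> (Write n a b d) st t st'"
inductive_cases EmitE: "exec ss cs \<Psi> (Emit a b) st t st'"
inductive_cases SeqE: "exec ss cs \<Psi> (Seq p q) st t st'"
inductive_cases CondE: "exec ss cs \<Psi> (Cond a p q) st t st'"
inductive_cases WhileE: "exec ss cs \<Psi> (While a p) st t st'"

lemma exec_deterministic:
  "exec ss cs \<Psi> p st t st' \<Longrightarrow> exec ss cs \<Psi> p st u st'' \<Longrightarrow> t = u \<and> st' = st''"
proof (induction arbitrary: u st'' rule: exec.induct)
  case (Seq p st t st' q t' st2)
  obtain v w st3 where "exec ss cs \<Psi> p st v st3" "exec ss cs \<Psi> q st3 w st''" "u = 1 + v + w"
    using Seq.prems by (rule SeqE) simp
  then show ?case using Seq.IH(1)[of v st3] Seq.IH(2)[of w st''] by simp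
next
  case (CondTrue \<sigma> a p Q t st' q)
  then obtain v where "exec ss cs \<Psi> p (\<sigma>, Q) v st''" "u = 1 + cost a + v"
    by (elim CondE) auto
  then show ?case using CondTrue.IH[of v st''] by simp
next
  case (CondFalse \<sigma> a q Q t st' p)
  then obtain v where "exec ss cs \<Psi> q (\<sigma>, Q) v st''" "u = 1 + cost a + v"
    by (elim CondE) auto
  then show ?case using CondFalse.IH[of v st''] by simp
next
  case (WhileFalse \<sigma> a p Q)
  show ?case using WhileFalse.prems by (rule WhileE) (use WhileFalse.hyps in simp_all)
next
  case (WhileTrue \<sigma> a p Q t st' t' st2)
  obtain v w st3 where "exec ss cs \<Psi> p (\<sigma>, Q) v st3" "exec ss cs \<Psi> (While a p) st3 w st''"
      "u = 1 + cost a + v + w"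
    using WhileTrue.prems by (rule WhileE) (use WhileTrue.hyps(1) in simp_all)
  then show ?case using WhileTrue.IH(1)[of v st3] WhileTrue.IH(2)[of w st''] by simp
qed (elim SkipE WriteE EmitE; simp)+

text \<open>
  On the given enumerations, \<open>p\<close> halts within \<open>b\<close> units of time and has emitted a possible
  output of the SNAC algorithm.
\<close>
definition implements_snac_within ::
  "com \<Rightarrow> nat \<Rightarrow> 's list \<Rightarrow> 'e set list \<Rightarrow> ('s \<Rightarrow> 's \<Rightarrow> 'e set) \<Rightarrow> bool" where
  "implements_snac_within p b ss cs \<Psi> \<longleftrightarrow>
     (\<exists>t \<sigma> Q. exec ss cs \<Psi> p (\<lambda>_ _ _. 0, {}) t (\<sigma>, Q) \<and> t \<le> b \<and>
        snac_output (set ss) (set cs) \<Psi> ((\<lambda>(i, j). {ss ! i, ss ! j}) ` Q))"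

end

theory Submission
  imports Defs
begin

text \<open>
  A set of pairs is sufficient iff it connects every class of every partition. Any sufficient
  set contains the trees of some run, so some output is minimum. Under joint permissibility every
  pair that some permissible event set does not separate has a largest such set; the pairs whose
  largest set is \<open>c\<close> join the components found in a class of \<open>c\<close>, so every sufficient set has
  at least as many of them there as the spanning tree chosen by the algorithm.

  The sizes of the event sets may exceed the time bound, and so may the cost of sorting them.
  The program therefore jumps from one size with a disconnected class to the next smaller one in
  time \<open>O(|C| |S|)\<close>; each such iteration adds a new pair, so there are at most \<open>|S|^2\<close> of them.
  Relabelling the components of all partitions after adding one pair also costs \<open>O(|C| |S|)\<close>.
\<close>

section \<open>Spanning trees on components\<close>

definition adj :: "'s set \<Rightarrow> 's set set \<Rightarrow> ('s \<times> 's) set" where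
  "adj X N = {(u, v). u \<in> X \<and> v \<in> X \<and> {u, v} \<in> N}"

lemma reach_rel_adj: "reach_rel X N = (adj X N)\<^sup>* \<inter> X \<times> X"
  by (auto simp: reach_rel_def adj_def)

lemma adj_mono: "X \<subseteq> Y \<Longrightarrow> N \<subseteq> M \<Longrightarrow> adj X N \<subseteq> adj Y M"
  by (auto simp: adj_def)

lemma reach_rel_mono: "X \<subseteq> Y \<Longrightarrow> N \<subseteq> M \<Longrightarrow> reach_rel X N \<subseteq> reach_rel Y M"
  unfolding reach_rel_adj using rtrancl_mono[OF adj_mono[of X Y N M]] by blast

lemma connected_graph_mono: "connected_graph X N \<Longrightarrow> N \<subseteq> M \<Longrightarrow> connected_graph X M"
  unfolding connected_graph_def using reach_rel_mono[of X X N M] by blast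

lemma equiv_reach_rel: "equiv X (reach_rel X N)"
proof (rule equivI)
  have "sym (adj X N)"
    unfolding adj_def sym_def by (simp add: doubleton_eq_iff) (metis insert_commute)
  then have "sym ((adj X N)\<^sup>*)"
    by (rule sym_rtrancl)
  then show "sym (reach_rel X N)"
    by (auto simp: reach_rel_adj sym_def)
  show "trans (reach_rel X N)"
    unfolding reach_rel_adj trans_def by (blast intro: rtrancl_trans)
qed (auto simp: reach_rel_adj refl_on_def)

lemma reach_rel_step: "\<lbrakk> u \<in> X; v \<in> X; {u, v} \<in> N \<rbrakk> \<Longrightarrow> (u, v) \<in> reach_rel X N"
  by (auto simp: reach_rel_adj adj_def)

lemma reach_rel_least:
  assumes "trans R" "refl_on X R"
    and "\<And>u v. \<lbrakk> u \<in> X; v \<in> X; {u, v} \<in> N \<rbrakk> \<Longrightarrow> (u, v) \<in> R"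
  shows "reach_rel X N \<subseteq> R"
proof (clarify)
  fix r s
  assume "(r, s) \<in> reach_rel X N"
  then have "(r, s) \<in> (adj X N)\<^sup>*" "r \<in> X"
    by (auto simp: reach_rel_adj)
  then show "(r, s) \<in> R"
  proof (induction rule: rtrancl_induct)
    case base
    then show ?case using assms(2) by (auto simp: refl_on_def)
  next
    case (step y z)
    then have "(y, z) \<in> R" using assms(3) by (simp add: adj_def)
    show ?case by (rule transD[OF assms(1) step.IH[OF step.prems] \<open>(y, z) \<in> R\<close>])
  qed
qed

lemma connected_graphI:
  assumes "connected_graph X M"
    and "\<And>u v. \<lbrakk> u \<in> X; v \<in> X; {u, v} \<in> M \<rbrakk> \<Longrightarrow> (u, v) \<in> reach_rel X N"
  shows "connected_graph X N"
proof -
  have "reach_rel X M \<subseteq> reach_rel X N"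
    using equiv_reach_rel[of X N] assms(2) by (intro reach_rel_least) (auto simp: equiv_def)
  then show ?thesis
    using assms(1) by (auto simp: connected_graph_def)
qed

definition labels :: "'s set \<Rightarrow> 's set set \<Rightarrow> ('s \<Rightarrow> 'a) \<Rightarrow> bool" where
  "labels X N f \<longleftrightarrow> (\<forall>r\<in>X. \<forall>s\<in>X. (r, s) \<in> reach_rel X N \<longleftrightarrow> f r = f s)"

lemma labels_cong:
  "(\<And>s. s \<in> X \<Longrightarrow> f s = g s) \<Longrightarrow> labels X N f \<longleftrightarrow> labels X N g"
  by (auto simp: labels_def)

lemma labels_class: "labels X N (\<lambda>r. reach_rel X N `` {r})"
  using eq_equiv_class_iff[OF equiv_reach_rel[of X N]] by (auto simp: labels_def)

lemma labels_relabel: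
  assumes "labels X N f" "u \<in> X" "v \<in> X"
  shows "labels X (insert {u, v} N) (\<lambda>t. if f t = f u then f v else f t)"
proof -
  let ?g = "\<lambda>t. if f t = f u then f v else f t"
  let ?R = "reach_rel X (insert {u, v} N)"
  have eq: "equiv X ?R" by (rule equiv_reach_rel)
  have "?R \<subseteq> {(r, s). r \<in> X \<and> s \<in> X \<and> ?g r = ?g s}"
  proof (rule reach_rel_least)
    fix r s assume rs: "r \<in> X" "s \<in> X" "{r, s} \<in> insert {u, v} N"
    show "(r, s) \<in> {(r, s). r \<in> X \<and> s \<in> X \<and> ?g r = ?g s}"
    proof (cases "{r, s} \<in> N")
      case True
      then have "f r = f s" using rs assms(1) reach_rel_step[of r X s N] by (auto simp: labels_def)
      then show ?thesis using rs by simp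
    next
      case False
      then show ?thesis using rs by (auto simp: doubleton_eq_iff)
    qed
  qed (auto simp: trans_def refl_on_def)
  moreover have "(r, s) \<in> ?R" if rs: "r \<in> X" "s \<in> X" "?g r = ?g s" for r s
  proof -
    have sub: "(a, b) \<in> ?R" if "a \<in> X" "b \<in> X" "f a = f b" for a b
      using that assms(1) reach_rel_mono[of X X N "insert {u, v} N"] by (auto simp: labels_def)
    have uv: "(u, v) \<in> ?R" using assms reach_rel_step[of u X v "insert {u, v} N"] by simp
    have sym: "(b, a) \<in> ?R" if "(a, b) \<in> ?R" for a b
      using eq that unfolding equiv_def by (meson symD)
    have trans: "(a, d) \<in> ?R" if "(a, b) \<in> ?R" "(b, d) \<in> ?R" for a b d
      using eq that unfolding equiv_def by (meson transD)
    consider "f r = f s" | "f r = f u" "f v = f s" | "f r = f v" "f u = f s"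
      using rs(3) by (auto split: if_splits)
    then show ?thesis
    proof cases
      case 1
      then show ?thesis using sub rs by blast
    next
      case 2
      then have "(r, u) \<in> ?R" "(v, s) \<in> ?R" using sub rs assms(2,3) by blast+
      then show ?thesis using uv trans by blast
    next
      case 3
      then have "(r, v) \<in> ?R" "(u, s) \<in> ?R" using sub rs assms(2,3) by blast+
      then show ?thesis using uv trans sym by blast
    qed
  qed
  ultimately show ?thesis by (auto simp: labels_def)
qed

lemma labels_insert_outside:
  assumes "labels X N f" "\<not> (u \<in> X \<and> v \<in> X)"
  shows "labels X (insert {u, v} N) f"
proof -
  have "adj X (insert {u, v} N) = adj X N"
    using assms(2) by (auto simp: adj_def doubleton_eq_iff)
  then show ?thesis using assms(1) by (simp add: labels_def reach_rel_adj)
qed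

lemma card_components_labels:
  assumes "labels X N f"
  shows "card (components X N) = card (f ` X)"
proof -
  let ?c = "\<lambda>a. {r \<in> X. f r = a}"
  have "reach_rel X N `` {r} = ?c (f r)" if "r \<in> X" for r
    using assms that by (auto simp: labels_def reach_rel_def)
  then have "components X N = ?c ` f ` X"
    unfolding components_def quotient_def by (auto simp: image_iff)
  moreover have "inj_on ?c (f ` X)"
    by (rule inj_onI) blast
  ultimately show ?thesis by (simp add: card_image)
qed

lemma card_components_insert:
  assumes "finite X" "u \<in> X" "v \<in> X" "(u, v) \<notin> reach_rel X N"
  shows "card (components X N) = Suc (card (components X (insert {u, v} N)))"
proof -
  let ?f = "\<lambda>r. reach_rel X N `` {r}"
  let ?g = "\<lambda>t. if ?f t = ?f u then ?f v else ?f t"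
  have "?f u \<noteq> ?f v" using assms labels_class[of X N] by (auto simp: labels_def)
  then have "?g ` X = ?f ` X - {?f u}" using assms(3) by auto
  moreover have "?f u \<in> ?f ` X" using assms(2) by blast
  moreover have "card (components X N) = card (?f ` X)"
    by (rule card_components_labels) (rule labels_class)
  moreover have "card (components X (insert {u, v} N)) = card (?g ` X)"
    by (rule card_components_labels) (rule labels_relabel[OF labels_class assms(2,3)])
  ultimately show ?thesis
    using assms(1) by (simp only: card_Suc_Diff1 finite_imageI)
qed

lemma component_tree_empty:
  assumes "X \<noteq> {}" "connected_graph X N"
  shows "component_tree X N {}"
proof -
  have "labels X N (\<lambda>_. 0 :: nat)"
    using assms(2) by (auto simp: labels_def connected_graph_def)
  then have "card (components X N) = 1"
    using assms(1) by (simp add: card_components_labels[of X N "\<lambda>_. 0 :: nat"] image_constant_conv)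
  then show ?thesis using assms(2) by (simp add: component_tree_def)
qed

lemma finite_pairs: "finite X \<Longrightarrow> finite (pairs X)"
  by (rule finite_subset[of _ "Pow X"]) (auto simp: pairs_def)

lemma component_tree_exists:
  assumes "finite X" "X \<noteq> {}" "M \<subseteq> pairs X" "connected_graph X (N \<union> M)"
  shows "\<exists>T\<subseteq>M. component_tree X N T"
  using assms(4)
proof (induction "card (components X N)" arbitrary: N)
  case 0
  have "reach_rel X N `` {r} \<in> components X N" if "r \<in> X" for r
    using that by (auto simp: components_def quotient_def)
  moreover have "finite (components X N)"
    unfolding components_def using assms(1)
    by (rule finite_quotient) (use equiv_reach_rel[of X N] in \<open>auto simp: reach_rel_def\<close>)
  ultimately show ?case using 0 assms(2) by auto
next
  case (Suc k)
  show ?case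
  proof (cases "connected_graph X N")
    case True
    then show ?thesis using component_tree_empty[OF assms(2)] by blast
  next
    case False
    then obtain u v where uv: "u \<in> X" "v \<in> X" "{u, v} \<in> N \<union> M" "(u, v) \<notin> reach_rel X N"
      using connected_graphI[OF Suc.prems] by blast
    then have uvM: "{u, v} \<in> M" using reach_rel_step[of u X v N] by blast
    have card: "card (components X N) = Suc (card (components X (insert {u, v} N)))"
      using assms(1) uv by (intro card_components_insert)
    have "connected_graph X (insert {u, v} N \<union> M)"
      using Suc.prems by (rule connected_graph_mono) blast
    then obtain T where T: "T \<subseteq> M" "component_tree X (insert {u, v} N) T"
      using Suc.hyps(1)[of "insert {u, v} N"] Suc.hyps(2) card by auto
    then have "finite T" "{u, v} \<notin> T"
      using finite_subset[OF _ finite_pairs[OF assms(1)]] by (auto simp: component_tree_def)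
    moreover have "{u, v} \<notin> N" using uv reach_rel_step[of u X v N] by blast
    moreover have "{u, v} \<in> pairs X" using uvM assms(3) by blast
    ultimately have "component_tree X N (insert {u, v} T)"
      using T(2) card by (simp add: component_tree_def)
    then show ?thesis using T(1) uvM by blast
  qed
qed

lemma component_tree_card_le:
  assumes "finite X" "X \<noteq> {}" "M \<subseteq> pairs X" "connected_graph X (N \<union> M)" "component_tree X N T"
  shows "card T \<le> card M"
proof -
  obtain T' where "T' \<subseteq> M" "component_tree X N T'"
    using component_tree_exists[OF assms(1-4)] by blast
  moreover have "finite M" using assms(1,3) finite_pairs finite_subset by blast
  ultimately show ?thesis
    using assms(5) card_mono[of M T'] by (simp add: component_tree_def)
qed

lemma component_tree_star:
  assumes "finite X" "labels X N f" "z \<in> X" "B \<subseteq> X" "inj_on f B" "f ` B = f ` X - {f z}"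
  shows "component_tree X N ((\<lambda>s. {s, z}) ` B)"
proof -
  let ?T = "(\<lambda>s. {s, z}) ` B"
  have fB: "f s \<noteq> f z" if "s \<in> B" for s using that assms(6) by blast
  then have zB: "z \<notin> B" by blast
  have "finite (f ` X)" using assms(1) by simp
  moreover have "card ?T = card B"
    by (rule card_image) (auto simp: inj_on_def doubleton_eq_iff)
  moreover have "card B = card (f ` B)" using assms(5) by (simp add: card_image)
  ultimately have "Suc (card ?T) = card (components X N)"
    using assms(3) by (simp only: assms(6) card_components_labels[OF assms(2)] card_Suc_Diff1 imageI)
  moreover have "?T \<subseteq> pairs X" using assms(3,4) zB by (auto simp: pairs_def)
  moreover have "{s, z} \<notin> N" if "s \<in> B" for s
    using fB[OF that] reach_rel_step[of s X z N] assms(2,3,4) that by (auto simp: labels_def)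
  moreover have "connected_graph X (N \<union> ?T)"
  proof -
    let ?R = "reach_rel X (N \<union> ?T)"
    have eq: "sym ?R" "trans ?R" using equiv_reach_rel[of X "N \<union> ?T"] by (auto simp: equiv_def)
    have sub: "(a, b) \<in> ?R" if "a \<in> X" "b \<in> X" "f a = f b" for a b
      using that assms(2) reach_rel_mono[of X X N "N \<union> ?T"] by (auto simp: labels_def)
    have "(r, z) \<in> ?R" if "r \<in> X" for r
    proof (cases "f r = f z")
      case True
      then show ?thesis using sub that assms(3) by blast
    next
      case False
      then have "f r \<in> f ` B" unfolding assms(6) using that by blast
      then obtain s where s: "s \<in> B" "f r = f s" by blast
      then have "(r, s) \<in> ?R" using sub that assms(4) by blast
      moreover have "(s, z) \<in> ?R" using s(1) assms(3,4) by (intro reach_rel_step) auto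
      ultimately show ?thesis using eq(2) by (meson transD)
    qed
    then show ?thesis
      using eq unfolding connected_graph_def by (meson symD transD)
  qed
  ultimately show ?thesis by (auto simp: component_tree_def)
qed

section \<open>Outputs of the algorithm\<close>

lemma finite_scenario_model:
  assumes "scenario_model E S C \<Psi>"
  shows "finite S" "finite C" "c \<in> C \<Longrightarrow> finite c"
  using assms finite_subset[of C "Pow E"] finite_subset[of c E] by (auto simp: scenario_model_def)

lemma equiv_indist_rel:
  "scenario_model E S C \<Psi> \<Longrightarrow> c \<in> C \<Longrightarrow> equiv S (indist_rel S \<Psi> c)"
  by (simp add: scenario_model_def)

lemma Pi_partition_subset: "X \<in> Pi_partition S \<Psi> c \<Longrightarrow> X \<subseteq> S"
  by (auto simp: Pi_partition_def quotient_def indist_rel_def)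

lemma Pi_partitionD:
  assumes "scenario_model E S C \<Psi>" "c \<in> C" "X \<in> Pi_partition S \<Psi> c"
  shows "X \<noteq> {}" "finite X" "r \<in> X \<Longrightarrow> s \<in> X \<longleftrightarrow> s \<in> S \<and> indist \<Psi> c r s"
proof -
  note eq = equiv_indist_rel[OF assms(1,2)]
  show "X \<noteq> {}"
    using in_quotient_imp_non_empty[OF eq] assms(3) by (simp add: Pi_partition_def)
  show "finite X"
    using finite_scenario_model(1)[OF assms(1)] Pi_partition_subset[OF assms(3)] finite_subset by blast
  show "s \<in> X \<longleftrightarrow> s \<in> S \<and> indist \<Psi> c r s" if "r \<in> X"
  proof
    assume "s \<in> X"
    then have "(r, s) \<in> indist_rel S \<Psi> c"
      using in_quotient_imp_in_rel[OF eq, of X r s] assms(3) that by (simp add: Pi_partition_def)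
    then show "s \<in> S \<and> indist \<Psi> c r s" by (simp add: indist_rel_def)
  next
    assume "s \<in> S \<and> indist \<Psi> c r s"
    then have "(r, s) \<in> indist_rel S \<Psi> c"
      using that Pi_partition_subset[OF assms(3)] by (auto simp: indist_rel_def)
    then show "s \<in> X"
      using in_quotient_imp_closed[OF eq, of X r s] assms(3) that by (simp add: Pi_partition_def)
  qed
qed

lemma Pi_partition_cover:
  assumes "scenario_model E S C \<Psi>" "c \<in> C" "r \<in> S"
  shows "\<exists>X\<in>Pi_partition S \<Psi> c. r \<in> X"
  using assms equiv_class_self[OF equiv_indist_rel[OF assms(1,2)]]
  by (auto simp: Pi_partition_def quotient_def)

lemma sufficient_iff_connected:
  fixes V :: "'v set" and E :: "'e set" and S :: "'s set"
  assumes V: "\<exists>a\<in>V. \<exists>b\<in>V. a \<noteq> b" and model: "scenario_model E S C \<Psi>"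
  shows "sufficient V S C \<Psi> N \<longleftrightarrow>
    N \<subseteq> pairs S \<and> (\<forall>c\<in>C. \<forall>X\<in>Pi_partition S \<Psi> c. connected_graph X N)"
proof (intro iffI conjI ballI)
  assume suf: "sufficient V S C \<Psi> N"
  then show NS: "N \<subseteq> pairs S" by (simp add: sufficient_def)
  fix c X
  assume c: "c \<in> C" and X: "X \<in> Pi_partition S \<Psi> c"
  note XD = Pi_partitionD[OF model c X] and XS = Pi_partition_subset[OF X]
  show "connected_graph X N"
    unfolding connected_graph_def
  proof (intro ballI, rule ccontr)
    fix r s
    assume rs: "r \<in> X" "s \<in> X" "(r, s) \<notin> reach_rel X N"
    obtain a b where ab: "a \<in> V" "b \<in> V" "a \<noteq> b" using V by blast
    let ?Y = "reach_rel X N `` {r}"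
    let ?x = "\<lambda>t d. if d = c \<and> t \<in> ?Y then a else b"
    have "nac C \<Psi> ?x u v" if uv: "{u, v} \<in> N" for u v
      unfolding nac_def
    proof (intro ballI impI)
      fix d assume "d \<in> C" and ind: "indist \<Psi> d u v"
      show "?x u d = ?x v d"
      proof (cases "d = c")
        case True
        have uvS: "u \<in> S" "v \<in> S"
          using uv NS by (auto simp: pairs_def doubleton_eq_iff dest!: subsetD)
        have "u \<in> X \<longleftrightarrow> v \<in> X"
        proof
          show "v \<in> X" if "u \<in> X" using XD(3)[OF that] uvS ind True by simp
          show "u \<in> X" if "v \<in> X"
          proof -
            obtain Y where Y: "Y \<in> Pi_partition S \<Psi> c" "u \<in> Y"
              using Pi_partition_cover[OF model c uvS(1)] by blast
            then have "v \<in> Y" using Pi_partitionD(3)[OF model c Y(1,2)] uvS ind True by simp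
            then have "indist \<Psi> c v u" using Pi_partitionD(3)[OF model c Y(1), of v u] Y(2) by simp
            then show ?thesis using XD(3)[OF that] uvS by simp
          qed
        qed
        moreover have "u \<in> ?Y \<longleftrightarrow> v \<in> ?Y" if "u \<in> X" "v \<in> X"
        proof -
          have "(u, v) \<in> reach_rel X N" using that uv by (rule reach_rel_step)
          then show ?thesis
            using equiv_reach_rel[of X N] unfolding equiv_def Image_singleton_iff by (meson symD transD)
        qed
        moreover have "?Y \<subseteq> X" by (auto simp: reach_rel_def)
        ultimately show ?thesis by auto
      qed simp
    qed
    moreover have "\<forall>t\<in>S. \<forall>d\<in>C. ?x t d \<in> V" using ab by simp
    moreover have "r \<noteq> s" using rs equiv_reach_rel[of X N] by (auto simp: equiv_def refl_on_def)
    moreover have "r \<in> S" "s \<in> S" using rs XS by auto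
    ultimately have "nac C \<Psi> ?x r s"
      using suf[unfolded sufficient_def, THEN conjunct2, THEN spec, of ?x] by simp
    moreover have "indist \<Psi> c r s" using XD(3)[OF rs(1)] rs(2) by blast
    ultimately have "?x r c = ?x s c" using c unfolding nac_def by blast
    moreover have "r \<in> ?Y" using rs equiv_reach_rel[of X N] by (auto simp: equiv_def refl_on_def)
    ultimately show False using rs(3) ab(3) by (auto split: if_splits)
  qed
next
  assume *: "N \<subseteq> pairs S \<and> (\<forall>c\<in>C. \<forall>X\<in>Pi_partition S \<Psi> c. connected_graph X N)"
  show "sufficient V S C \<Psi> N"
    unfolding sufficient_def
  proof (intro conjI allI impI ballI)
    fix x :: "'s \<Rightarrow> 'e set \<Rightarrow> 'v" and r s
    assume x: "(\<forall>s\<in>S. \<forall>c\<in>C. x s c \<in> V) \<and> (\<forall>r s. {r, s} \<in> N \<longrightarrow> nac C \<Psi> x r s)"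
      and rs: "r \<in> S" "s \<in> S"
    show "nac C \<Psi> x r s"
      unfolding nac_def
    proof (intro ballI impI)
      fix c assume c: "c \<in> C" and ind: "indist \<Psi> c r s"
      obtain X where X: "X \<in> Pi_partition S \<Psi> c" "r \<in> X"
        using Pi_partition_cover[OF model c rs(1)] by blast
      note XD = Pi_partitionD(3)[OF model c X(1)]
      have "reach_rel X N \<subseteq> {(u, v). u \<in> X \<and> v \<in> X \<and> x u c = x v c}"
      proof (rule reach_rel_least)
        fix u v assume uv: "u \<in> X" "v \<in> X" "{u, v} \<in> N"
        then have "indist \<Psi> c u v" using XD[of u v] by simp
        moreover have "nac C \<Psi> x u v" using x uv(3) by blast
        ultimately show "(u, v) \<in> {(u, v). u \<in> X \<and> v \<in> X \<and> x u c = x v c}"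
          using uv c by (simp add: nac_def)
      qed (auto simp: trans_def refl_on_def)
      moreover have "s \<in> X" using XD[OF X(2)] rs ind by simp
      then have "(r, s) \<in> reach_rel X N"
        using * c X by (auto simp: connected_graph_def)
      ultimately show "x r c = x s c" by blast
    qed
  qed (use * in simp)
qed

lemma sufficient_pairs: "sufficient V S C \<Psi> (pairs S)"
proof -
  have "{r, s} \<in> pairs S" if "r \<in> S" "s \<in> S" "r \<noteq> s" for r s
    using that by (auto simp: pairs_def)
  then show ?thesis by (simp add: sufficient_def)
qed

lemma connected_graph_Int_pairs: "connected_graph X (N \<inter> pairs X)" if "connected_graph X N"
proof (rule connected_graphI[OF that])
  fix u v assume uv: "u \<in> X" "v \<in> X" "{u, v} \<in> N"
  show "(u, v) \<in> reach_rel X (N \<inter> pairs X)"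
  proof (cases "u = v")
    case True
    then show ?thesis using uv equiv_reach_rel[of X] by (auto simp: equiv_def refl_on_def)
  next
    case False
    then show ?thesis using uv by (intro reach_rel_step) (auto simp: pairs_def)
  qed
qed

lemma snac_step_exists:
  assumes model: "scenario_model E S C \<Psi>" and k: "k \<ge> 0"
    and M: "\<And>c X. c \<in> C \<Longrightarrow> X \<in> Pi_partition S \<Psi> c \<Longrightarrow> connected_graph X M"
  shows "\<exists>N'. snac_step S C \<Psi> (k, N) (k - 1, N') \<and> N' \<subseteq> N \<union> M"
proof -
  have "\<exists>T\<subseteq>M. component_tree X N T" if cX: "c \<in> C" "X \<in> Pi_partition S \<Psi> c" for c X
  proof -
    have "connected_graph X (N \<union> M \<inter> pairs X)"
      using connected_graph_Int_pairs[OF M[OF cX]] by (rule connected_graph_mono) blast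
    then obtain T where "T \<subseteq> M \<inter> pairs X" "component_tree X N T"
      using component_tree_exists[of X "M \<inter> pairs X" N] Pi_partitionD(1,2)[OF model cX] by blast
    then show ?thesis by blast
  qed
  then have "\<forall>c X. \<exists>T. c \<in> C \<and> X \<in> Pi_partition S \<Psi> c \<longrightarrow> T \<subseteq> M \<and> component_tree X N T"
    by blast
  then obtain T where
    T: "\<And>c X. c \<in> C \<and> X \<in> Pi_partition S \<Psi> c \<Longrightarrow> T c X \<subseteq> M \<and> component_tree X N (T c X)"
    by metis
  have "snac_step S C \<Psi> (k, N)
      (k - 1, N \<union> (\<Union>c\<in>{c\<in>C. int (card c) = k}. \<Union>X\<in>Pi_partition S \<Psi> c. T c X))"
    using k T by (intro snac_step.intros) auto
  moreover have "N \<union> (\<Union>c\<in>{c\<in>C. int (card c) = k}. \<Union>X\<in>Pi_partition S \<Psi> c. T c X) \<subseteq> N \<union> M"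
    using T by auto
  ultimately show ?thesis by blast
qed

lemma snac_run_exists:
  assumes "scenario_model E S C \<Psi>"
    and "\<And>c X. c \<in> C \<Longrightarrow> X \<in> Pi_partition S \<Psi> c \<Longrightarrow> connected_graph X M"
  shows "\<exists>N'. (snac_step S C \<Psi>)\<^sup>*\<^sup>* (int j - 1, N) (-1, N') \<and> N' \<subseteq> N \<union> M"
proof (induction j arbitrary: N)
  case 0
  then show ?case by auto
next
  case (Suc j)
  obtain N1 where N1: "snac_step S C \<Psi> (int (Suc j) - 1, N) (int j - 1, N1)" "N1 \<subseteq> N \<union> M"
    using snac_step_exists[where k = "int j" and N = N and M = M, OF assms(1)] assms(2) by auto
  obtain N2 where "(snac_step S C \<Psi>)\<^sup>*\<^sup>* (int j - 1, N1) (-1, N2)" "N2 \<subseteq> N1 \<union> M"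
    using Suc.IH by blast
  then show ?case using N1 by (meson Un_least converse_rtranclp_into_rtranclp order_trans sup_ge2)
qed

lemma snac_skip:
  assumes model: "scenario_model E S C \<Psi>"
    and conn: "\<And>c X. c \<in> C \<Longrightarrow> k' < int (card c) \<Longrightarrow> X \<in> Pi_partition S \<Psi> c \<Longrightarrow> connected_graph X N"
    and "-1 \<le> k'" "k' \<le> k"
  shows "(snac_step S C \<Psi>)\<^sup>*\<^sup>* (k, N) (k', N)"
  using assms(4)
proof (induction k rule: int_ge_induct)
  case (step k)
  have "snac_step S C \<Psi> (k + 1, N) (k + 1 - 1, N)"
  proof (rule snac_step.intros[where T = "\<lambda>_ _. {}"])
    show "\<forall>c\<in>C. int (card c) = k + 1 \<longrightarrow> (\<forall>X\<in>Pi_partition S \<Psi> c. component_tree X N {})"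
      using conn step.hyps Pi_partitionD(1)[OF model] by (auto intro!: component_tree_empty)
  qed (use assms(3) step.hyps in auto)
  then show ?case using step.IH by (simp add: converse_rtranclp_into_rtranclp)
qed simp

lemma snac_reachable_invariant:
  assumes model: "scenario_model E S C \<Psi>"
    and run: "(snac_step S C \<Psi>)\<^sup>*\<^sup>* (snac_init C) (k, N)"
  shows "N \<subseteq> pairs S \<and>
    (\<forall>c\<in>C. \<forall>X\<in>Pi_partition S \<Psi> c. k < int (card c) \<longrightarrow> connected_graph X N)"
  using run unfolding snac_init_def
proof (induction rule: rtranclp_induct2)
  case refl
  have "card c \<le> Max (card ` C)" if "c \<in> C" for c
    using that finite_scenario_model(2)[OF model] by simp
  then show ?case by (force simp: snac_init_def)
next
  case (step k N k' N')
  from step.hyps(2) show ?case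
  proof cases
    case (1 T)
    have sub: "T c X \<subseteq> pairs S" if "c \<in> C" "int (card c) = k" "X \<in> Pi_partition S \<Psi> c" for c X
    proof -
      have "T c X \<subseteq> pairs X" using 1 that by (auto simp: component_tree_def)
      moreover have "pairs X \<subseteq> pairs S"
        using Pi_partition_subset[OF that(3)] by (auto simp: pairs_def)
      ultimately show ?thesis by blast
    qed
    have "connected_graph X N'" if c: "c \<in> C" "X \<in> Pi_partition S \<Psi> c" "k' < int (card c)" for c X
    proof (cases "int (card c) = k")
      case True
      then have "connected_graph X (N \<union> T c X)" using 1 c by (simp add: component_tree_def)
      then show ?thesis by (rule connected_graph_mono) (use 1 c True in auto)
    next
      case False
      then have "connected_graph X N" using step.IH 1 c by auto
      then show ?thesis by (rule connected_graph_mono) (use 1 in auto)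
    qed
    moreover have "N' \<subseteq> pairs S" using step.IH 1(4) sub by auto
    ultimately show ?thesis by blast
  qed
qed

lemma snac_output_sufficient:
  fixes V :: "'v set"
  assumes "\<exists>a\<in>V. \<exists>b\<in>V. a \<noteq> b" "scenario_model E S C \<Psi>" "snac_output S C \<Psi> N"
  shows "sufficient V S C \<Psi> N"
  using assms(3) snac_reachable_invariant[OF assms(2), of _ N]
  unfolding sufficient_iff_connected[OF assms(1,2)] snac_output_def by fastforce

lemma snac_terminates:
  fixes S :: "'s set"
  assumes model: "scenario_model E S C \<Psi>"
  shows "snac_terminates S C \<Psi>"
  unfolding snac_terminates_def
proof (intro conjI allI impI notI)
  assume "\<exists>f :: nat \<Rightarrow> int \<times> 's set set. f 0 = snac_init C \<and> (\<forall>i. snac_step S C \<Psi> (f i) (f (Suc i)))"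
  then obtain f :: "nat \<Rightarrow> int \<times> 's set set" where f: "\<And>i. snac_step S C \<Psi> (f i) (f (Suc i))" by blast
  have step: "fst (f (Suc i)) = fst (f i) - 1" "fst (f i) \<ge> 0" for i
    using f[of i] by (auto elim!: snac_step.cases)
  have "fst (f i) = fst (f 0) - int i" for i
    by (induction i) (simp_all add: step(1))
  from this[of "nat (fst (f 0)) + 1"] show False
    using step(2)[of "nat (fst (f 0)) + 1"] step(2)[of 0] by linarith
next
  fix k N assume "(snac_step S C \<Psi>)\<^sup>*\<^sup>* (snac_init C) (k, N) \<and> 0 \<le> k"
  moreover have "connected_graph X (pairs S)" if "c \<in> C" "X \<in> Pi_partition S \<Psi> c" for c X
    using sufficient_iff_connected[OF _ model, of "UNIV :: bool set" "pairs S"] sufficient_pairs that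
    by auto
  ultimately show "\<exists>y. snac_step S C \<Psi> (k, N) y"
    using snac_step_exists[OF model, of k "pairs S" N] by blast
qed

lemma minimum_output_exists:
  fixes V :: "'v set"
  assumes V: "\<exists>a\<in>V. \<exists>b\<in>V. a \<noteq> b" and model: "scenario_model E S C \<Psi>"
  shows "\<exists>N. snac_output S C \<Psi> N \<and> minimum_sufficient V S C \<Psi> N"
proof -
  obtain M where M: "sufficient V S C \<Psi> M" "\<And>N'. sufficient V S C \<Psi> N' \<Longrightarrow> card M \<le> card N'"
    using ex_has_least_nat[of "sufficient V S C \<Psi>" "pairs S" card] sufficient_pairs by blast
  have conn: "M \<subseteq> pairs S" "\<And>c X. c \<in> C \<Longrightarrow> X \<in> Pi_partition S \<Psi> c \<Longrightarrow> connected_graph X M"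
    using M(1) by (auto simp: sufficient_iff_connected[OF V model])
  obtain N where "(snac_step S C \<Psi>)\<^sup>*\<^sup>* (snac_init C) (-1, N)" and NM: "N \<subseteq> M"
    using snac_run_exists[where j = "Suc (Max (card ` C))" and N = "{}" and M = M, OF model] conn(2)
    by (auto simp: snac_init_def)
  then have out: "snac_output S C \<Psi> N" unfolding snac_output_def by force
  moreover have "finite M" using conn(1) finite_pairs[OF finite_scenario_model(1)[OF model]] finite_subset by blast
  then have "card N \<le> card M" using NM by (simp add: card_mono)
  then have "\<forall>N'. sufficient V S C \<Psi> N' \<longrightarrow> card N \<le> card N'" using M(2) order_trans by blast
  ultimately show ?thesis
    using snac_output_sufficient[OF V model out] by (auto simp: minimum_sufficient_def)
qed

text \<open>
  Under joint permissibility the pairs of a class that are not yet indistinguishable under a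
  larger permissible event set belong to no other class of the same iteration. Every sufficient
  set spends on them at least as many pairs as the algorithm.
\<close>
lemma output_minimum:
  fixes V :: "'v set" and E :: "'e set" and S :: "'s set"
  assumes V: "\<exists>a\<in>V. \<exists>b\<in>V. a \<noteq> b" and model: "scenario_model E S C \<Psi>"
    and joint: "jointly_permissible S C \<Psi>" and out: "snac_output S C \<Psi> N"
  shows "minimum_sufficient V S C \<Psi> N"
  unfolding minimum_sufficient_def
proof (intro conjI allI impI)
  show "sufficient V S C \<Psi> N" using V model out by (rule snac_output_sufficient)
  fix M assume "sufficient V S C \<Psi> M"
  then have M: "M \<subseteq> pairs S" "\<And>c X. c \<in> C \<Longrightarrow> X \<in> Pi_partition S \<Psi> c \<Longrightarrow> connected_graph X M"
    by (auto simp: sufficient_iff_connected[OF V model])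
  have finM: "finite M"
    using M(1) finite_pairs[OF finite_scenario_model(1)[OF model]] finite_subset by blast
  define high where
    "high k e \<longleftrightarrow> (\<exists>d\<in>C. k < int (card d) \<and> (\<forall>r\<in>e. \<forall>s\<in>e. indist \<Psi> d r s))" for k :: int and e
  have bound: "card N \<le> card {e \<in> M. high k e}"
    if "(snac_step S C \<Psi>)\<^sup>*\<^sup>* (snac_init C) (k, N)" for k N
    using that unfolding snac_init_def
  proof (induction rule: rtranclp_induct2)
    case refl
    then show ?case by (simp add: snac_init_def)
  next
    case (step k N k' N')
    from step.hyps(2) show ?case
    proof cases
      case (1 T)
      define I where "I = Sigma {c \<in> C. int (card c) = k} (Pi_partition S \<Psi>)"
      define P where "P i = {e \<in> M. e \<in> pairs (snd i) \<and> \<not> high k e}" for i :: "'e set \<times> 's set"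
      have ID: "fst i \<in> C" "int (card (fst i)) = k" "snd i \<in> Pi_partition S \<Psi> (fst i)" if "i \<in> I" for i
        using that by (auto simp: I_def)
      have finP: "finite (P i)" for i using finM by (simp add: P_def)
      have tree: "card (T (fst i) (snd i)) \<le> card (P i)" if i: "i \<in> I" for i
      proof -
        obtain c X where cX: "i = (c, X)" by fastforce
        have c: "c \<in> C" "int (card c) = k" "X \<in> Pi_partition S \<Psi> c" using ID[OF i] cX by auto
        have "connected_graph X (N \<union> P i)"
        proof (rule connected_graphI[OF connected_graph_Int_pairs[OF M(2)[OF c(1,3)]]])
          fix u v assume uv: "u \<in> X" "v \<in> X" "{u, v} \<in> M \<inter> pairs X"
          show "(u, v) \<in> reach_rel X (N \<union> P i)"
          proof (cases "high k {u, v}")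
            case True
            then obtain d where d: "d \<in> C" "k < int (card d)" "indist \<Psi> d u v" by (auto simp: high_def)
            have uvS: "u \<in> S" "v \<in> S" "u \<noteq> v"
              using uv Pi_partition_subset[OF c(3)] by (auto simp: pairs_def doubleton_eq_iff)
            have "indist \<Psi> c u v" using Pi_partitionD(3)[OF model c(1,3) uv(1)] uv(2) by simp
            then obtain b where b: "b \<in> C" "c \<union> d \<subseteq> b" "indist \<Psi> b u v"
              using joint uvS c(1) d unfolding jointly_permissible_def by meson
            have "card d \<le> card b"
              using b(2) finite_scenario_model(3)[OF model b(1)] by (intro card_mono) auto
            then have kb: "k < int (card b)" using d(2) by simp
            obtain Y where Y: "Y \<in> Pi_partition S \<Psi> b" "u \<in> Y"
              using Pi_partition_cover[OF model b(1) uvS(1)] by blast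
            note YD = Pi_partitionD(3)[OF model b(1) Y]
            have "v \<in> Y" using YD uvS b(3) by simp
            moreover have "connected_graph Y N"
              using snac_reachable_invariant[OF model step.hyps(1)[folded snac_init_def]] b(1) Y(1) kb by blast
            ultimately have "(u, v) \<in> reach_rel Y N" using Y(2) by (simp add: connected_graph_def)
            moreover have "Y \<subseteq> X"
              using YD b(2) Pi_partitionD(3)[OF model c(1,3) uv(1)] unfolding indist_def by blast
            ultimately show ?thesis using reach_rel_mono[of Y X N "N \<union> P i"] by blast
          next
            case False
            then have "{u, v} \<in> P i" using uv cX by (simp add: P_def)
            then show ?thesis using uv by (intro reach_rel_step) auto
          qed
        qed
        moreover have "P i \<subseteq> pairs X" using cX by (auto simp: P_def)
        moreover have "component_tree X N (T c X)" using 1 c by simp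
        ultimately show ?thesis
          using component_tree_card_le[of X "P i" N] Pi_partitionD(1,2)[OF model c(1,3)] cX by simp
      qed
      have disj: "P i \<inter> P j = {}" if ij: "i \<in> I" "j \<in> I" "i \<noteq> j" for i j
      proof (rule ccontr)
        assume "P i \<inter> P j \<noteq> {}"
        then obtain e where e: "e \<in> P i" "e \<in> P j" by blast
        then obtain r s where rs: "e = {r, s}" "r \<noteq> s" "r \<in> snd i" "s \<in> snd i"
          by (auto simp: P_def pairs_def)
        have rsj: "r \<in> snd j" "s \<in> snd j" using e(2) rs(1) by (auto simp: P_def pairs_def)
        note iD = ID[OF ij(1)] and jD = ID[OF ij(2)]
        note iC = Pi_partitionD(3)[OF model iD(1,3)] and jC = Pi_partitionD(3)[OF model jD(1,3)]
        have inS: "r \<in> S" "s \<in> S" using Pi_partition_subset[OF iD(3)] rs by auto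
        show False
        proof (cases "fst i = fst j")
          case True
          have "x \<in> snd i \<longleftrightarrow> x \<in> snd j" for x
            using iC[OF rs(3), of x] jC[OF rsj(1), of x] by (simp only: True)
          then have "snd i = snd j" by blast
          then show False using True ij(3) by (simp add: prod_eq_iff)
        next
          case False
          have "indist \<Psi> (fst i) r s" "indist \<Psi> (fst j) r s"
            using iC[OF rs(3), of s] jC[OF rsj(1), of s] rs(4) rsj(2) by simp_all
          then obtain b where b: "b \<in> C" "fst i \<union> fst j \<subseteq> b" "indist \<Psi> b r s"
            using joint inS rs(2) iD(1) jD(1) unfolding jointly_permissible_def by meson
          have fb: "finite b" using finite_scenario_model(3)[OF model b(1)] .
          have "\<not> k \<ge> int (card b)"
          proof
            assume "k \<ge> int (card b)"
            then have "fst i = b" "fst j = b"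
              using card_seteq[OF fb, of "fst i"] card_seteq[OF fb, of "fst j"] b(2) iD(2) jD(2) by auto
            then show False using False by simp
          qed
          moreover have "indist \<Psi> b s r" "indist \<Psi> b r r" "indist \<Psi> b s s"
          proof -
            obtain Y where Y: "Y \<in> Pi_partition S \<Psi> b" "r \<in> Y"
              using Pi_partition_cover[OF model b(1) inS(1)] by blast
            note YD = Pi_partitionD(3)[OF model b(1) Y(1)]
            have "s \<in> Y" using YD[OF Y(2)] inS b(3) by simp
            then show "indist \<Psi> b s r" "indist \<Psi> b r r" "indist \<Psi> b s s"
              using YD[of s r] YD[of r r] YD[of s s] Y(2) by simp_all
          qed
          ultimately have "high k e" using b(1,3) rs(1) unfolding high_def by (intro bexI[of _ b]) auto
          then show False using e(1) by (simp add: P_def)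
        qed
      qed
      have finI: "finite I"
      proof -
        have "finite (Pi_partition S \<Psi> c)" for c
          using finite_subset[of "Pi_partition S \<Psi> c" "Pow S"] Pi_partition_subset
            finite_scenario_model(1)[OF model] by blast
        then show ?thesis using finite_scenario_model(2)[OF model] by (simp add: I_def)
      qed
      have N': "N' = N \<union> (\<Union>i\<in>I. T (fst i) (snd i))" using 1(4) by (auto simp: I_def)
      have "card N' \<le> card N + card (\<Union>i\<in>I. T (fst i) (snd i))"
        unfolding N' by (rule card_Un_le)
      also have "\<dots> \<le> card N + (\<Sum>i\<in>I. card (T (fst i) (snd i)))"
        using card_UN_le[OF finI] by simp
      also have "\<dots> \<le> card {e \<in> M. high k e} + (\<Sum>i\<in>I. card (P i))"
        using step.IH tree by (intro add_mono sum_mono) auto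
      also have "\<dots> = card {e \<in> M. high k e} + card (\<Union>i\<in>I. P i)"
        using finI finP disj by (subst card_UN_disjoint) auto
      also have "\<dots> = card ({e \<in> M. high k e} \<union> (\<Union>i\<in>I. P i))"
        using finM finI finP by (intro card_Un_disjoint[symmetric]) (auto simp: P_def)
      also have "\<dots> \<le> card {e \<in> M. high k' e}"
      proof (rule card_mono)
        have "high k' e" if e: "e \<in> P i" and i: "i \<in> I" for e i
        proof -
          obtain r s where rs: "e = {r, s}" "r \<in> snd i" "s \<in> snd i"
            using e by (auto simp: P_def pairs_def)
          have "\<forall>r\<in>e. \<forall>s\<in>e. indist \<Psi> (fst i) r s"
            using rs Pi_partitionD(3)[OF model ID(1,3)[OF i]] by blast
          then show ?thesis
            unfolding high_def using ID(1,2)[OF i] 1(1) by (intro bexI[of _ "fst i"]) auto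
        qed
        moreover have "high k' e" if hk: "high k e" for e
        proof -
          obtain d where "d \<in> C" "k < int (card d)" "\<forall>r\<in>e. \<forall>s\<in>e. indist \<Psi> d r s"
            using hk unfolding high_def by blast
          then show ?thesis
            unfolding high_def using 1(1) by (intro bexI[of _ d]) auto
        qed
        ultimately show "{e \<in> M. high k e} \<union> (\<Union>i\<in>I. P i) \<subseteq> {e \<in> M. high k' e}"
          by (auto simp: P_def)
      qed (use finM in simp)
      finally show ?thesis .
    qed
  qed
  obtain k where "(snac_step S C \<Psi>)\<^sup>*\<^sup>* (snac_init C) (k, N)"
    using out by (auto simp: snac_output_def)
  then have "card N \<le> card {e \<in> M. high k e}" by (rule bound)
  also have "\<dots> \<le> card M" using finM by (intro card_mono) auto
  finally show "card N \<le> card M" .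
qed

section \<open>Reasoning about programs and their running time\<close>

definition runs ::
  "'s list \<Rightarrow> 'e set list \<Rightarrow> ('s \<Rightarrow> 's \<Rightarrow> 'e set) \<Rightarrow> com \<Rightarrow> store \<Rightarrow> (nat \<times> nat) set \<Rightarrow>
   (nat \<Rightarrow> store \<Rightarrow> (nat \<times> nat) set \<Rightarrow> bool) \<Rightarrow> bool" where
  "runs ss cs \<Psi> p \<sigma> Q P \<longleftrightarrow> (\<exists>t \<sigma>' Q'. exec ss cs \<Psi> p (\<sigma>, Q) t (\<sigma>', Q') \<and> P t \<sigma>' Q')"

abbreviation var :: "nat \<Rightarrow> expr" where
  "var x \<equiv> Read x (Num 0) (Num 0)"

abbreviation assign :: "nat \<Rightarrow> expr \<Rightarrow> com" where
  "assign x a \<equiv> Write x (Num 0) (Num 0) a"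

definition For :: "nat \<Rightarrow> expr \<Rightarrow> com \<Rightarrow> com" where
  "For x e p = Seq (assign x (Num 0))
     (While (Less (var x) e) (Seq p (assign x (Plus (var x) (Num 1)))))"

lemma upd_other: "a \<noteq> n \<Longrightarrow> upd \<sigma> n i j v a = \<sigma> a"
  by (simp add: upd_def)

lemma upd_same: "upd \<sigma> n i j v n = (\<lambda>i' j'. if i' = i \<and> j' = j then v else \<sigma> n i' j')"
  by (auto simp: upd_def fun_eq_iff)

context
  fixes ss :: "'s list" and cs :: "'e set list" and \<Psi> :: "'s \<Rightarrow> 's \<Rightarrow> 'e set"
begin

abbreviation "run \<equiv> runs ss cs \<Psi>"
abbreviation "value_of \<equiv> val ss cs \<Psi>"

lemma runs_mono:
  "run p \<sigma> Q P \<Longrightarrow> (\<And>t \<sigma>' Q'. P t \<sigma>' Q' \<Longrightarrow> P' t \<sigma>' Q') \<Longrightarrow> run p \<sigma> Q P'"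
  unfolding runs_def by blast

lemma runs_Skip: "P 1 \<sigma> Q \<Longrightarrow> run Skip \<sigma> Q P"
  unfolding runs_def by (blast intro: exec.Skip)

lemma runs_Write:
  "P (1 + cost a + cost b + cost d) (upd \<sigma> x (value_of \<sigma> a) (value_of \<sigma> b) (value_of \<sigma> d)) Q
    \<Longrightarrow> run (Write x a b d) \<sigma> Q P"
  unfolding runs_def by (blast intro: exec.Write)

lemma runs_Emit:
  "P (1 + cost a + cost b) \<sigma> (insert (value_of \<sigma> a, value_of \<sigma> b) Q) \<Longrightarrow> run (Emit a b) \<sigma> Q P"
  unfolding runs_def by (blast intro: exec.Emit)

lemma runs_Seq:
  "run p \<sigma> Q (\<lambda>t \<sigma>' Q'. run q \<sigma>' Q' (\<lambda>t'. P (1 + t + t'))) \<Longrightarrow> run (Seq p q) \<sigma> Q P"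
  unfolding runs_def by (blast intro: exec.Seq)

lemma runs_Cond:
  assumes "value_of \<sigma> a \<noteq> 0 \<Longrightarrow> run p \<sigma> Q (\<lambda>t. P (1 + cost a + t))"
    and "value_of \<sigma> a = 0 \<Longrightarrow> run q \<sigma> Q (\<lambda>t. P (1 + cost a + t))"
  shows "run (Cond a p q) \<sigma> Q P"
  using assms unfolding runs_def
  by (cases "value_of \<sigma> a = 0") (blast intro: exec.CondTrue exec.CondFalse)+

lemmas runs_rules = runs_Skip runs_Write runs_Emit runs_Seq runs_Cond

text \<open>The potential \<open>\<phi>\<close> pays for the iterations, \<open>W\<close> units of time per unit of potential.\<close>
lemma runs_While:
  fixes \<phi> :: "store \<Rightarrow> (nat \<times> nat) set \<Rightarrow> nat"
  assumes step: "\<And>\<sigma> Q. I \<sigma> Q \<Longrightarrow> value_of \<sigma> a \<noteq> 0 \<Longrightarrow>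
      run p \<sigma> Q (\<lambda>t \<sigma>' Q'. I \<sigma>' Q' \<and> \<phi> \<sigma>' Q' < \<phi> \<sigma> Q \<and>
        1 + cost a + t \<le> W * (\<phi> \<sigma> Q - \<phi> \<sigma>' Q'))"
    and init: "I \<sigma> Q"
    and final: "\<And>t \<sigma>' Q'. I \<sigma>' Q' \<Longrightarrow> value_of \<sigma>' a = 0 \<Longrightarrow>
      t \<le> 1 + cost a + W * \<phi> \<sigma> Q \<Longrightarrow> P t \<sigma>' Q'"
  shows "run (While a p) \<sigma> Q P"
proof -
  have "\<exists>t \<sigma>' Q'. exec ss cs \<Psi> (While a p) (\<sigma>, Q) t (\<sigma>', Q') \<and> I \<sigma>' Q' \<and>
      value_of \<sigma>' a = 0 \<and> t \<le> 1 + cost a + W * \<phi> \<sigma> Q"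
    using init
  proof (induction "\<phi> \<sigma> Q" arbitrary: \<sigma> Q rule: less_induct)
    case less
    show ?case
    proof (cases "value_of \<sigma> a = 0")
      case True
      then have "exec ss cs \<Psi> (While a p) (\<sigma>, Q) (1 + cost a) (\<sigma>, Q)"
        by (rule exec.WhileFalse)
      then show ?thesis using less.prems True by force
    next
      case False
      obtain t \<sigma>1 Q1 where 1: "exec ss cs \<Psi> p (\<sigma>, Q) t (\<sigma>1, Q1)" "I \<sigma>1 Q1" "\<phi> \<sigma>1 Q1 < \<phi> \<sigma> Q"
          "1 + cost a + t \<le> W * (\<phi> \<sigma> Q - \<phi> \<sigma>1 Q1)"
        using step[OF less.prems False] unfolding runs_def by blast
      obtain t' \<sigma>2 Q2 where 2: "exec ss cs \<Psi> (While a p) (\<sigma>1, Q1) t' (\<sigma>2, Q2)" "I \<sigma>2 Q2"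
          "value_of \<sigma>2 a = 0" "t' \<le> 1 + cost a + W * \<phi> \<sigma>1 Q1"
        using less.hyps[OF 1(3,2)] by blast
      have "W * (\<phi> \<sigma> Q - \<phi> \<sigma>1 Q1) + W * \<phi> \<sigma>1 Q1 = W * \<phi> \<sigma> Q"
        using 1(3) by (simp flip: distrib_left)
      then have "1 + cost a + t + t' \<le> 1 + cost a + W * \<phi> \<sigma> Q"
        using 1(4) 2(4) by linarith
      then show ?thesis using exec.WhileTrue[OF False 1(1) 2(1)] 2(2,3) by blast
    qed
  qed
  then show ?thesis unfolding runs_def using final by blast
qed

lemma runs_For:
  assumes init: "I 0 (upd \<sigma> x 0 0 0) Q"
    and step: "\<And>i \<sigma> Q. i < N \<Longrightarrow> \<sigma> x 0 0 = i \<Longrightarrow> I i \<sigma> Q \<Longrightarrow>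
      run p \<sigma> Q (\<lambda>t \<sigma>' Q'. t \<le> b \<and> \<sigma>' x 0 0 = i \<and> I (Suc i) (upd \<sigma>' x 0 0 (Suc i)) Q')"
    and bound: "\<And>i \<sigma> Q. I i \<sigma> Q \<Longrightarrow> value_of \<sigma> e = N"
    and final: "\<And>t \<sigma>' Q'. I N \<sigma>' Q' \<Longrightarrow> t \<le> (b + cost e + 20) * (N + 1) \<Longrightarrow> P t \<sigma>' Q'"
  shows "run (For x e p) \<sigma> Q P"
proof -
  let ?W = "b + cost e + 20"
  let ?I = "\<lambda>\<sigma> Q. \<sigma> x 0 0 \<le> N \<and> I (\<sigma> x 0 0) \<sigma> Q"
  show ?thesis
    unfolding For_def
  proof (intro runs_Seq runs_Write, rule runs_While[where I = ?I and W = ?W and \<phi> = "\<lambda>\<sigma> _. N - \<sigma> x 0 0"])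
    fix \<sigma> Q assume I: "?I \<sigma> Q" and lt: "value_of \<sigma> (Less (var x) e) \<noteq> 0"
    have "\<sigma> x 0 0 < N" using I lt bound by (auto split: if_splits)
    from step[of "\<sigma> x 0 0" \<sigma> Q, OF this refl] I
    have "run p \<sigma> Q (\<lambda>t \<sigma>' Q'. t \<le> b \<and> \<sigma>' x 0 0 = \<sigma> x 0 0 \<and>
        I (Suc (\<sigma> x 0 0)) (upd \<sigma>' x 0 0 (Suc (\<sigma> x 0 0))) Q')" by blast
    then show "run (Seq p (assign x (Plus (var x) (Num 1)))) \<sigma> Q (\<lambda>t \<sigma>' Q'. ?I \<sigma>' Q' \<and>
        N - \<sigma>' x 0 0 < N - \<sigma> x 0 0 \<and>
        1 + cost (Less (var x) e) + t \<le> ?W * (N - \<sigma> x 0 0 - (N - \<sigma>' x 0 0)))"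
      using \<open>\<sigma> x 0 0 < N\<close>
      by (intro runs_Seq, elim runs_mono) (auto intro!: runs_Write simp: upd_same Suc_diff_le)
  next
    show "?I (upd \<sigma> x (value_of \<sigma> (Num 0)) (value_of \<sigma> (Num 0)) (value_of \<sigma> (Num 0))) Q"
      using init by (simp add: upd_same)
  next
    fix t \<sigma>' Q'
    assume "?I \<sigma>' Q'" "value_of \<sigma>' (Less (var x) e) = 0" and
      t: "t \<le> 1 + cost (Less (var x) e) + ?W * (N - upd \<sigma> x (value_of \<sigma> (Num 0)) (value_of \<sigma> (Num 0))
        (value_of \<sigma> (Num 0)) x 0 0)"
    then have "I N \<sigma>' Q'" using bound[of _ \<sigma>' Q'] by (auto simp: not_less split: if_splits)
    then show "P (1 + (1 + cost (Num 0) + cost (Num 0) + cost (Num 0)) + t) \<sigma>' Q'"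
      by (rule final) (use t in \<open>simp add: upd_same\<close>)
  qed
qed

end

section \<open>The program\<close>

text \<open>
  Arrays 0 to 7 hold scalars: 0, 1, 2 and 5 are loop counters, 3 is the successor of the largest
  size of an event set with a disconnected class (0 if there is none), 4 is the length of the list
  in array 11, 6 and 7 are the two labels to be merged. Cell \<open>(c, s)\<close> of array 8 is the label of
  the component of scenario \<open>s\<close> in its class under event set \<open>c\<close>, a member of that component that
  carries itself as label; cell \<open>(c, s)\<close> of array 9 is a fixed representative of the class of \<open>s\<close>
  under \<open>c\<close>; array 10 marks the emitted pairs; array 11 lists the pairs emitted in the current
  iteration.
\<close>

definition init_prog :: com where
  "init_prog = For 0 NumEventSets (For 1 NumScenarios
     (Seq (Write 8 (var 0) (var 1) (var 1)) (Seq (Write 9 (var 0) (var 1) (var 1))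
       (For 2 NumScenarios (Cond (Indist (var 0) (var 2) (var 1))
         (Write 9 (var 0) (var 1) (var 2)) Skip)))))"

definition bad_test :: expr where
  "bad_test = Less (Equal (Read 8 (var 0) (Read 9 (var 0) (var 1))) (var 1))
     (Equal (Read 8 (var 0) (var 1)) (var 1))"

definition select_prog :: com where
  "select_prog = Seq (assign 3 (Num 0)) (For 0 NumEventSets (For 1 NumScenarios
     (Cond bad_test
       (Cond (Less (var 3) (Plus (EventSetSize (var 0)) (Num 1)))
         (assign 3 (Plus (EventSetSize (var 0)) (Num 1))) Skip) Skip)))"

definition collect_prog :: com where
  "collect_prog = Seq (assign 4 (Num 0)) (For 0 NumEventSets
     (Cond (Equal (var 3) (Plus (EventSetSize (var 0)) (Num 1)))
       (For 1 NumScenarios (Cond bad_test (Cond (Read 10 (var 1) (Read 9 (var 0) (var 1))) Skip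
         (Seq (Write 10 (var 1) (Read 9 (var 0) (var 1)) (Num 1))
         (Seq (Write 11 (var 4) (Num 0) (var 1))
         (Seq (Write 11 (var 4) (Num 1) (Read 9 (var 0) (var 1)))
         (Seq (assign 4 (Plus (var 4) (Num 1)))
         (Emit (var 1) (Read 9 (var 0) (var 1)))))))) Skip)) Skip))"

definition merge_prog :: com where
  "merge_prog = For 5 (var 4) (For 0 NumEventSets
     (Cond (Indist (var 0) (Read 11 (var 5) (Num 0)) (Read 11 (var 5) (Num 1)))
       (Seq (assign 6 (Read 8 (var 0) (Read 11 (var 5) (Num 0))))
       (Seq (assign 7 (Read 8 (var 0) (Read 11 (var 5) (Num 1))))
         (For 2 NumScenarios (Cond (Equal (Read 8 (var 0) (var 2)) (var 6))
           (Write 8 (var 0) (var 2) (var 7)) Skip)))) Skip))"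

definition snac_prog :: com where
  "snac_prog = Seq init_prog (Seq select_prog
     (While (var 3) (Seq collect_prog (Seq merge_prog select_prog))))"

primrec last_index :: "(nat \<Rightarrow> bool) \<Rightarrow> nat \<Rightarrow> nat \<Rightarrow> nat" where
  "last_index P d 0 = d"
| "last_index P d (Suc i) = (if P i then i else last_index P d i)"

lemma last_index_spec: "i < n \<Longrightarrow> P i \<Longrightarrow> last_index P d n < n \<and> P (last_index P d n)"
  by (induction n) (auto simp: less_Suc_eq)

lemma last_index_cong:
  "\<lbrakk> \<And>j. j < n \<Longrightarrow> P j = P' j; \<exists>j<n. P j \<rbrakk> \<Longrightarrow> last_index P d n = last_index P' d' n"
  by (induction n) (auto simp: less_Suc_eq)

definition bad :: "(nat \<Rightarrow> nat \<Rightarrow> nat) \<Rightarrow> (nat \<Rightarrow> nat \<Rightarrow> nat) \<Rightarrow> nat \<Rightarrow> nat \<Rightarrow> bool" where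
  "bad L R c s \<longleftrightarrow> L c s = s \<and> L c (R c s) \<noteq> s"

lemma loop_bound:
  "\<lbrakk> t \<le> (k * x + j + 20) * (y + 1); 1 \<le> x; k + j + 20 + l \<le> k' \<rbrakk>
    \<Longrightarrow> l + t \<le> k' * x * (y + 1 :: nat)"
proof -
  assume t: "t \<le> (k * x + j + 20) * (y + 1)" and x: "1 \<le> x" and k: "k + j + 20 + l \<le> k'"
  have "l + (k * x + j + 20) * (y + 1) \<le> (k * x + (j + 20 + l)) * (y + 1)"
    by (simp add: algebra_simps)
  also have "\<dots> \<le> k' * x * (y + 1)"
  proof (rule mult_le_mono1)
    have "k * x + (j + 20 + l) \<le> (k + j + 20 + l) * x"
      using mult_le_mono2[OF x, of "j + 20 + l"] by (simp add: algebra_simps)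
    also have "\<dots> \<le> k' * x" using k by (rule mult_le_mono1)
    finally show "k * x + (j + 20 + l) \<le> k' * x" .
  qed
  finally show ?thesis using t by simp
qed

locale snac_input =
  fixes ss :: "'s list" and cs :: "'e set list" and \<Psi> :: "'s \<Rightarrow> 's \<Rightarrow> 'e set"
begin

abbreviation "ind c r s \<equiv> indist \<Psi> (cs ! c) (ss ! r) (ss ! s)"
abbreviation "m \<equiv> length cs"
abbreviation "n \<equiv> length ss"

definition representative :: "nat \<Rightarrow> nat \<Rightarrow> nat" where
  "representative c s = last_index (\<lambda>r. ind c r s) s n"

lemma runs_init:
  "runs ss cs \<Psi> init_prog \<sigma> Q (\<lambda>t \<sigma>' Q'. t \<le> 200 * (n + 1) ^ 2 * (m + 1) \<and> Q' = Q \<and>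
     (\<forall>c<m. \<forall>s<n. \<sigma>' 8 c s = s \<and> \<sigma>' 9 c s = representative c s) \<and> \<sigma>' 10 = \<sigma> 10)"
  unfolding init_prog_def
proof (rule runs_For[where N = m and b = "150 * (n + 1) ^ 2"
      and I = "\<lambda>i \<sigma>' Q'. Q' = Q \<and> \<sigma>' 10 = \<sigma> 10 \<and>
        (\<forall>c<i. \<forall>s<n. \<sigma>' 8 c s = s \<and> \<sigma>' 9 c s = representative c s)"], goal_cases)
  case 1
  then show ?case by (simp add: upd_other)
next
  case outer: (2 c \<sigma>1 Q1)
  show ?case
  proof (rule runs_For[where N = n and b = "100 * (n + 1)"
      and I = "\<lambda>i \<sigma>' Q'. Q' = Q \<and> \<sigma>' 10 = \<sigma> 10 \<and> \<sigma>' 0 0 0 = c \<and>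
        (\<forall>c'<c. \<forall>s<n. \<sigma>' 8 c' s = s \<and> \<sigma>' 9 c' s = representative c' s) \<and>
        (\<forall>s<i. \<sigma>' 8 c s = s \<and> \<sigma>' 9 c s = representative c s)"], goal_cases)
    case 1
    then show ?case using outer by (simp add: upd_other)
  next
    case mid: (2 s \<sigma>2 Q2)
    show ?case
    proof (intro runs_Seq runs_Write, rule runs_For[where N = n and b = 30
      and I = "\<lambda>i \<sigma>' Q'. Q' = Q \<and> \<sigma>' 10 = \<sigma> 10 \<and> \<sigma>' 0 0 0 = c \<and> \<sigma>' 1 0 0 = s \<and>
        (\<forall>c'<c. \<forall>s<n. \<sigma>' 8 c' s = s \<and> \<sigma>' 9 c' s = representative c' s) \<and>
        (\<forall>s'<s. \<sigma>' 8 c s' = s' \<and> \<sigma>' 9 c s' = representative c s') \<and>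
        \<sigma>' 8 c s = s \<and> \<sigma>' 9 c s = last_index (\<lambda>r. ind c r s) s i"], goal_cases)
      case 1
      then show ?case using mid by (auto simp: upd_other upd_same)
    next
      case inner: (2 r \<sigma>3 Q3)
      then show ?case using outer(1) mid(1)
        by (intro runs_rules) (auto simp: upd_other upd_same split: if_splits)
    next
      case 4
      then show ?case by (auto simp: upd_other upd_same less_Suc_eq representative_def)
    qed simp
  next
    case (4 t)
    have "(100 * (n + 1) + 21) * (n + 1) \<le> 150 * (n + 1)^2"
      by (simp add: power2_eq_square algebra_simps)
    then show ?case using 4 by (auto simp: upd_other less_Suc_eq)
  qed simp
next
  case (4 t)
  then show ?case using loop_bound[OF 4(2), of 0 200] by simp
qed simp

definition relabelled :: "nat \<Rightarrow> nat \<Rightarrow> (nat \<Rightarrow> nat \<Rightarrow> nat) \<Rightarrow> nat \<Rightarrow> nat \<Rightarrow> nat" where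
  "relabelled u v L = (\<lambda>c t. if c < m \<and> t < n \<and> u < n \<and> v < n \<and> ind c u v \<and> L c t = L c u
     then L c v else L c t)"

lemma runs_select:
  "runs ss cs \<Psi> select_prog \<sigma> Q (\<lambda>t \<sigma>' Q'. t \<le> 200 * (n + 1) * (m + 1) \<and> Q' = Q \<and>
     (\<forall>x\<in>{8,9,10}. \<sigma>' x = \<sigma> x) \<and>
     (\<forall>c<m. \<forall>s<n. bad (\<sigma> 8) (\<sigma> 9) c s \<longrightarrow> card (cs ! c) < \<sigma>' 3 0 0) \<and>
     (\<sigma>' 3 0 0 \<noteq> 0 \<longrightarrow>
       (\<exists>c<m. \<exists>s<n. bad (\<sigma> 8) (\<sigma> 9) c s \<and> \<sigma>' 3 0 0 = Suc (card (cs ! c)))))"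
  unfolding select_prog_def
proof (intro runs_Seq runs_Write, rule runs_For[where N = m and b = "100 * (n + 1)"
      and I = "\<lambda>i \<sigma>' Q'. Q' = Q \<and> (\<forall>x\<in>{8,9,10}. \<sigma>' x = \<sigma> x) \<and>
        (\<forall>c<i. \<forall>s<n. bad (\<sigma> 8) (\<sigma> 9) c s \<longrightarrow> card (cs ! c) < \<sigma>' 3 0 0) \<and>
        (\<sigma>' 3 0 0 \<noteq> 0 \<longrightarrow>
          (\<exists>c<m. \<exists>s<n. bad (\<sigma> 8) (\<sigma> 9) c s \<and> \<sigma>' 3 0 0 = Suc (card (cs ! c))))"], goal_cases)
  case 1
  then show ?case by (simp add: upd_other upd_same)
next
  case outer: (2 c \<sigma>1 Q1)
  show ?case
  proof (rule runs_For[where N = n and b = 60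
      and I = "\<lambda>i \<sigma>' Q'. Q' = Q \<and> \<sigma>' 0 0 0 = c \<and> (\<forall>x\<in>{8,9,10}. \<sigma>' x = \<sigma> x) \<and>
        (\<forall>c'<c. \<forall>s<n. bad (\<sigma> 8) (\<sigma> 9) c' s \<longrightarrow> card (cs ! c') < \<sigma>' 3 0 0) \<and>
        (\<forall>s<i. bad (\<sigma> 8) (\<sigma> 9) c s \<longrightarrow> card (cs ! c) < \<sigma>' 3 0 0) \<and>
        (\<sigma>' 3 0 0 \<noteq> 0 \<longrightarrow>
          (\<exists>c<m. \<exists>s<n. bad (\<sigma> 8) (\<sigma> 9) c s \<and> \<sigma>' 3 0 0 = Suc (card (cs ! c))))"], goal_cases)
    case 1
    then show ?case using outer by (simp add: upd_other)
  next
    case inner: (2 s \<sigma>2 Q2)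
    have test: "val ss cs \<Psi> \<sigma>2 bad_test \<noteq> 0 \<longleftrightarrow> bad (\<sigma> 8) (\<sigma> 9) c s"
      using inner by (auto simp: bad_test_def bad_def)
    have cost: "cost bad_test = 27" by (simp add: bad_test_def)
    show ?case
    proof (rule runs_Cond, goal_cases)
      case 1
      then have b: "bad (\<sigma> 8) (\<sigma> 9) c s" using test by simp
      show ?case
      proof (rule runs_Cond, goal_cases)
        case 1
        have "\<sigma>2 3 0 0 < Suc (card (cs ! c))" using 1 inner outer(1) by (auto split: if_splits)
        then have "\<forall>c'<c. \<forall>s<n. bad (\<sigma> 8) (\<sigma> 9) c' s \<longrightarrow> card (cs ! c') < Suc (card (cs ! c))"
          "\<forall>s'<s. bad (\<sigma> 8) (\<sigma> 9) c s' \<longrightarrow> card (cs ! c) < Suc (card (cs ! c))"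
          using inner by (meson less_trans)+
        then show ?case
          using inner outer(1) b cost
          by (intro runs_Write) (auto simp: upd_other upd_same less_Suc_eq)
      next
        case 2
        then have "card (cs ! c) < \<sigma>2 3 0 0" using inner outer(1) by (auto split: if_splits)
        then show ?case
          using inner cost by (intro runs_Skip) (simp add: upd_other upd_same less_Suc_eq)
      qed
    next
      case 2
      then have "\<not> bad (\<sigma> 8) (\<sigma> 9) c s" using test by simp
      then show ?case
        using inner outer(1) cost by (intro runs_rules) (auto simp: upd_other upd_same less_Suc_eq)
    qed
  next
    case (4 t)
    then show ?case by (auto simp: upd_other less_Suc_eq)
  qed simp
next
  case (4 t)
  then show ?case using loop_bound[OF 4(2), of 5 200] by simp
qed simp

lemma runs_merge:
  assumes J: "\<And>i L. i < \<sigma> 4 0 0 \<Longrightarrow> J i L \<Longrightarrow> J (Suc i) (relabelled (\<sigma> 11 i 0) (\<sigma> 11 i 1) L)"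
    and J0: "J 0 (\<sigma> 8)"
  shows "runs ss cs \<Psi> merge_prog \<sigma> Q (\<lambda>t \<sigma>' Q'.
     t \<le> 300 * (n + 1) * (m + 1) * (\<sigma> 4 0 0 + 1) \<and> Q' = Q \<and>
     (\<forall>x\<in>{9,10}. \<sigma>' x = \<sigma> x) \<and> J (\<sigma> 4 0 0) (\<sigma>' 8))"
  unfolding merge_prog_def
proof (rule runs_For[where N = "\<sigma> 4 0 0" and b = "250 * ((n + 1) * (m + 1))"
      and I = "\<lambda>i \<sigma>' Q'. Q' = Q \<and> (\<forall>x\<in>{4,9,10,11}. \<sigma>' x = \<sigma> x) \<and> J i (\<sigma>' 8)"], goal_cases)
  case 1
  then show ?case using J0 by (simp add: upd_other)
next
  case outer: (2 i \<sigma>1 Q1)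
  define u v where "u = \<sigma> 11 i 0" and "v = \<sigma> 11 i 1"
  define L where "L = \<sigma>1 8"
  show ?case
  proof (rule runs_For[where N = m and b = "200 * (n + 1)"
      and I = "\<lambda>c \<sigma>' Q'. Q' = Q \<and> \<sigma>' 5 0 0 = i \<and> (\<forall>x\<in>{4,9,10,11}. \<sigma>' x = \<sigma> x) \<and>
        \<sigma>' 8 = (\<lambda>c'. if c' < c then relabelled u v L c' else L c')"], goal_cases)
    case 1
    then show ?case using outer by (simp add: upd_other L_def)
  next
    case mid: (2 c \<sigma>2 Q2)
    have uv: "val ss cs \<Psi> \<sigma>2 (Read 11 (var 5) (Num 0)) = u"
      "val ss cs \<Psi> \<sigma>2 (Read 11 (var 5) (Num 1)) = v"
      using mid by (simp_all add: u_def v_def)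
    show ?case
    proof (rule runs_Cond, goal_cases)
      case 1
      then have ind: "ind c u v" "u < n" "v < n" using mid uv by (auto split: if_splits)
      show ?case
      proof (intro runs_Seq runs_Write, rule runs_For[where N = n and b = 40
          and I = "\<lambda>t \<sigma>' Q'. Q' = Q \<and> \<sigma>' 0 0 0 = c \<and> \<sigma>' 5 0 0 = i \<and>
            \<sigma>' 6 0 0 = L c u \<and> \<sigma>' 7 0 0 = L c v \<and> (\<forall>x\<in>{4,9,10,11}. \<sigma>' x = \<sigma> x) \<and>
            \<sigma>' 8 = (\<lambda>c' t'. if c' < c \<or> c' = c \<and> t' < t then relabelled u v L c' t' else L c' t')"],
          goal_cases)
        case 1
        then show ?case using mid uv by (auto simp: upd_other upd_same fun_eq_iff)
      next
        case inner: (2 t \<sigma>3 Q3)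
        then show ?case using mid(1) ind
          by (intro runs_rules)
            (auto simp: upd_other upd_same fun_eq_iff less_Suc_eq relabelled_def)
      next
        case (4 t)
        then show ?case using mid(1) ind
          by (auto simp: upd_other fun_eq_iff less_Suc_eq relabelled_def)
      qed simp
    next
      case 2
      then have "\<not> (ind c u v \<and> u < n \<and> v < n)" using mid uv by auto
      then show ?case using mid
        by (intro runs_rules) (auto simp: upd_other fun_eq_iff less_Suc_eq relabelled_def)
    qed
  next
    case (4 t)
    have "t \<le> 250 * ((n + 1) * (m + 1))"
      using loop_bound[OF 4(2), of 0 250] by (simp del: mult_Suc mult_Suc_right add: mult.assoc)
    moreover have "\<sigma>' 8 = relabelled u v L" if "\<sigma>' 8 = (\<lambda>c'. if c' < m then relabelled u v L c' else L c')"
      for \<sigma>' :: store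
      using that by (auto simp: fun_eq_iff relabelled_def)
    ultimately show ?case using 4 J[of i L] outer
      by (simp del: mult_Suc mult_Suc_right distrib_left_numeral add: upd_other u_def v_def L_def)
  qed simp
next
  case (4 t)
  have "t \<le> 300 * ((n + 1) * (m + 1)) * (\<sigma> 4 0 0 + 1)" using loop_bound[OF 4(2), of 0 300] by simp
  then have "t \<le> 300 * (n + 1) * (m + 1) * (\<sigma> 4 0 0 + 1)" by (simp only: mult.assoc)
  then show ?case using 4(1) by auto
qed simp

lemma runs_collect:
  assumes K: "\<sigma> 3 0 0 = K"
    and A: "\<And>x y. \<sigma> 10 x y = 0 \<longleftrightarrow> (x, y) \<notin> Q"
    and Q: "Q \<subseteq> {..<n} \<times> {..<n}"
    and R: "\<And>c s. c < m \<Longrightarrow> s < n \<Longrightarrow> \<sigma> 9 c s < n"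
  shows "runs ss cs \<Psi> collect_prog \<sigma> Q (\<lambda>t \<sigma>' Q'. t \<le> 200 * (n + 1) * (m + 1) \<and>
     (\<forall>x\<in>{3,8,9}. \<sigma>' x = \<sigma> x) \<and>
     Q' = Q \<union> {(s, \<sigma> 9 c s) | c s. c < m \<and> s < n \<and> K = Suc (card (cs ! c)) \<and> bad (\<sigma> 8) (\<sigma> 9) c s} \<and>
     (\<forall>x y. \<sigma>' 10 x y = 0 \<longleftrightarrow> (x, y) \<notin> Q') \<and> Q' \<subseteq> {..<n} \<times> {..<n} \<and>
     Q' = Q \<union> (\<lambda>i. (\<sigma>' 11 i 0, \<sigma>' 11 i 1)) ` {..<\<sigma>' 4 0 0} \<and> card Q' = card Q + \<sigma>' 4 0 0)"
proof -
  define new where "new c s = {(s', \<sigma> 9 c' s') | c' s'. c' < m \<and> s' < n \<and> (c' < c \<or> c' = c \<and> s' < s) \<and>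
    K = Suc (card (cs ! c')) \<and> bad (\<sigma> 8) (\<sigma> 9) c' s'}" for c s
  have new0: "new 0 0 = {}" by (auto simp: new_def)
  have new_row: "new c n = new (Suc c) 0" for c by (auto simp: new_def less_Suc_eq)
  have new_skip: "new c n = new c 0" if "K \<noteq> Suc (card (cs ! c))" for c
    using that by (auto simp: new_def)
  have new_Suc: "new c (Suc s) = (if K = Suc (card (cs ! c)) \<and> bad (\<sigma> 8) (\<sigma> 9) c s
      then insert (s, \<sigma> 9 c s) (new c s) else new c s)" if "c < m" "s < n" for c s
    using that by (auto simp: new_def less_Suc_eq)
  define J where "J c s \<sigma>' Q' \<longleftrightarrow> (\<forall>x\<in>{3,8,9}. \<sigma>' x = \<sigma> x) \<and> Q' = Q \<union> new c s \<and>
     (\<forall>x y. \<sigma>' 10 x y = 0 \<longleftrightarrow> (x, y) \<notin> Q') \<and> Q' \<subseteq> {..<n} \<times> {..<n} \<and>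
     Q' = Q \<union> (\<lambda>i. (\<sigma>' 11 i 0, \<sigma>' 11 i 1)) ` {..<\<sigma>' 4 0 0} \<and> card Q' = card Q + \<sigma>' 4 0 0"
    for c s and \<sigma>' :: store and Q'
  have J_upd: "J c s (upd \<sigma>' x i j v) Q' = J c s \<sigma>' Q'" if "x \<in> {0,1}" for c s \<sigma>' Q' x i j v
  proof -
    have "y \<noteq> x" if "y \<in> {3, 4, 8, 9, 10, 11}" for y using that \<open>x \<in> {0,1}\<close> by auto
    then show ?thesis unfolding J_def by (simp add: upd_other)
  qed
  show ?thesis
    unfolding collect_prog_def
  proof (intro runs_Seq runs_Write, rule runs_For[where N = m and b = "150 * (n + 1)"
      and I = "\<lambda>c \<sigma>' Q'. J c 0 \<sigma>' Q'"], goal_cases)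
    case 1
    then show ?case using A Q by (simp add: J_upd J_def new0 upd_other upd_same)
  next
    case outer: (2 c \<sigma>1 Q1)
    show ?case
    proof (rule runs_Cond, goal_cases)
      case 1
      then have Kc: "K = Suc (card (cs ! c))"
        using outer K by (auto simp: J_def split: if_splits)
      show ?case
      proof (rule runs_For[where N = n and b = "100"
          and I = "\<lambda>s \<sigma>' Q'. \<sigma>' 0 0 0 = c \<and> J c s \<sigma>' Q'"], goal_cases)
        case 1
        then show ?case using outer by (simp add: J_upd upd_other)
      next
        case inner: (2 s \<sigma>2 Q2)
        have test: "val ss cs \<Psi> \<sigma>2 bad_test \<noteq> 0 \<longleftrightarrow> bad (\<sigma> 8) (\<sigma> 9) c s"
          using inner by (auto simp: bad_test_def bad_def J_def)
        have cost: "cost bad_test = 27" by (simp add: bad_test_def)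
        have r: "\<sigma>2 9 c s = \<sigma> 9 c s" "\<sigma> 9 c s < n" using inner R outer(1) by (auto simp: J_def)
        have J2: "J c s \<sigma>2 Q2" and c: "\<sigma>2 0 0 0 = c" and s: "\<sigma>2 1 0 0 = s" using inner by auto
        show ?case
        proof (rule runs_Cond, goal_cases)
          case 1
          then have b: "bad (\<sigma> 8) (\<sigma> 9) c s" using test by simp
          then have new: "new c (Suc s) = insert (s, \<sigma> 9 c s) (new c s)"
            using new_Suc[OF outer(1) inner(1)] Kc by simp
          let ?r = "\<sigma> 9 c s" and ?k = "\<sigma>2 4 0 0"
          let ?\<sigma> = "upd (upd (upd (upd \<sigma>2 10 s ?r 1) 11 ?k 0 s) 11 ?k 1 ?r) 4 0 0 (Suc ?k)"
          note J2' = J2[unfolded J_def]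
          have J2_10: "\<forall>x y. \<sigma>2 10 x y = 0 \<longleftrightarrow> (x, y) \<notin> Q2"
            and J2_new: "Q2 = Q \<union> new c s" and J2_sub: "Q2 \<subseteq> {..<n} \<times> {..<n}"
            and J2_card: "card Q2 = card Q + \<sigma>2 4 0 0"
            using J2' by blast+
          have old: "J c (Suc s) \<sigma>2 Q2" if "(s, ?r) \<in> Q2"
            using J2 that new by (auto simp: J_def)
          have ext: "J c (Suc s) ?\<sigma> (insert (s, ?r) Q2)" if "(s, ?r) \<notin> Q2"
          proof -
            have im: "(\<lambda>i. (?\<sigma> 11 i 0, ?\<sigma> 11 i 1)) ` {..<Suc ?k} =
                insert (s, ?r) ((\<lambda>i. (\<sigma>2 11 i 0, \<sigma>2 11 i 1)) ` {..<?k})"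
              unfolding lessThan_Suc image_insert
              by (intro arg_cong2[of _ _ _ _ insert] image_cong) (simp_all add: upd_other upd_same)
            have Q2: "Q \<union> (\<lambda>i. (\<sigma>2 11 i 0, \<sigma>2 11 i 1)) ` {..<?k} = Q2" using J2' by blast
            have "?\<sigma> 4 0 0 = Suc ?k" by (simp add: upd_same)
            then have "insert (s, ?r) Q2 = Q \<union> (\<lambda>i. (?\<sigma> 11 i 0, ?\<sigma> 11 i 1)) ` {..<?\<sigma> 4 0 0}"
              by (simp only: im Un_insert_right Q2)
            moreover have "finite Q2" by (rule finite_subset[OF J2_sub]) simp
            then have "card (insert (s, ?r) Q2) = card Q + ?\<sigma> 4 0 0"
              using J2_card that by (simp add: upd_same)
            moreover have "\<forall>x y. ?\<sigma> 10 x y = 0 \<longleftrightarrow> (x, y) \<notin> insert (s, ?r) Q2"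
              using J2_10 by (simp add: upd_other upd_same)
            moreover have "insert (s, ?r) Q2 = Q \<union> new c (Suc s)" using J2_new new by simp
            moreover have "\<forall>x\<in>{3,8,9}. ?\<sigma> x = \<sigma> x" using J2' by (simp add: upd_other)
            moreover have "insert (s, ?r) Q2 \<subseteq> {..<n} \<times> {..<n}"
              using J2_sub r(2) inner(1) by simp
            ultimately show ?thesis unfolding J_def by blast
          qed
          show ?case
          proof (rule runs_Cond, goal_cases)
            case 1
            then have "(s, ?r) \<in> Q2" using J2_10 c s r by simp
            then show ?case using old c s cost by (intro runs_Skip) (simp add: J_upd upd_other)
          next
            case 2
            then have "(s, ?r) \<notin> Q2" using J2_10 c s r by simp
            then show ?case
              using ext c s r cost
              by (intro runs_Seq runs_Write runs_Emit) (simp add: J_upd upd_other upd_same)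
          qed
        next
          case 2
          then have "J c s = J c (Suc s)"
            using new_Suc[OF outer(1) inner(1)] test by (simp add: J_def fun_eq_iff)
          then show ?case using inner cost by (intro runs_Skip) (simp add: J_upd upd_other)
        qed
      next
        case (4 t)
        have "J c n = J (Suc c) 0" by (simp add: J_def new_row fun_eq_iff)
        then show ?case using 4 outer by (simp add: J_upd)
      qed simp
    next
      case 2
      then have "K \<noteq> Suc (card (cs ! c))" using outer K by (auto simp: J_def)
      then have "J c 0 = J (Suc c) 0"
        using new_skip new_row by (simp add: J_def fun_eq_iff)
      then show ?case using outer by (intro runs_Skip) (simp add: J_upd)
    qed
  next
    case (4 t \<sigma>' Q')
    have "new m 0 = {(s, \<sigma> 9 c s) | c s. c < m \<and> s < n \<and> K = Suc (card (cs ! c)) \<and> bad (\<sigma> 8) (\<sigma> 9) c s}"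
      by (auto simp: new_def)
    then have "J m 0 \<sigma>' Q' \<longleftrightarrow> (\<forall>x\<in>{3,8,9}. \<sigma>' x = \<sigma> x) \<and>
        Q' = Q \<union> {(s, \<sigma> 9 c s) | c s. c < m \<and> s < n \<and> K = Suc (card (cs ! c)) \<and> bad (\<sigma> 8) (\<sigma> 9) c s} \<and>
        (\<forall>x y. \<sigma>' 10 x y = 0 \<longleftrightarrow> (x, y) \<notin> Q') \<and> Q' \<subseteq> {..<n} \<times> {..<n} \<and>
        Q' = Q \<union> (\<lambda>i. (\<sigma>' 11 i 0, \<sigma>' 11 i 1)) ` {..<\<sigma>' 4 0 0} \<and> card Q' = card Q + \<sigma>' 4 0 0"
      unfolding J_def by (simp only:)
    moreover have "5 + t \<le> 200 * (n + 1) * (m + 1)"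
      using loop_bound[OF 4(2), of 5 200] by simp
    moreover have "1 + (1 + cost (Num 0) + cost (Num 0) + cost (Num 0)) + t = 5 + t" by simp
    ultimately show ?case using 4(1) by (simp only:)
  qed simp
qed

end

section \<open>Correctness of the program\<close>

locale snac_instance = snac_input ss cs \<Psi>
  for ss :: "'s list" and cs :: "'e set list" and \<Psi> :: "'s \<Rightarrow> 's \<Rightarrow> 'e set" +
  fixes E :: "'e set"
  assumes model: "scenario_model E (set ss) (set cs) \<Psi>"
    and distinct: "distinct ss" "distinct cs"
begin

abbreviation "step \<equiv> snac_step (set ss) (set cs) \<Psi>"
abbreviation "start \<equiv> snac_init (set cs)"
abbreviation "classes c \<equiv> Pi_partition (set ss) \<Psi> (cs ! c)"
abbreviation "edges Q \<equiv> (\<lambda>(i, j). {ss ! i, ss ! j}) ` Q"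

definition position :: "'s \<Rightarrow> nat" where
  "position = the_inv_into {..<n} ((!) ss)"

lemma position_nth [simp]: "i < n \<Longrightarrow> position (ss ! i) = i"
  unfolding position_def using distinct(1) by (intro the_inv_into_f_f inj_on_nth) auto

lemma position_set: "s \<in> set ss \<Longrightarrow> position s < n \<and> ss ! position s = s"
  by (auto simp: in_set_conv_nth)

lemma ind_equiv:
  assumes "c < m" "i < n" "j < n"
  shows "ind c i i" "ind c i j \<Longrightarrow> ind c j i" "k < n \<Longrightarrow> ind c i j \<Longrightarrow> ind c j k \<Longrightarrow> ind c i k"
proof -
  have eq: "equiv (set ss) (indist_rel (set ss) \<Psi> (cs ! c))"
    using assms by (intro equiv_indist_rel[OF model]) simp
  have rel: "(ss ! a, ss ! b) \<in> indist_rel (set ss) \<Psi> (cs ! c) \<longleftrightarrow> ind c a b" if "a < n" "b < n" for a b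
    using that by (simp add: indist_rel_def)
  show "ind c i i" using eq rel[of i i] assms by (auto simp: equiv_def refl_on_def)
  show "ind c j i" if "ind c i j" using eq rel[of i j] rel[of j i] that assms
    unfolding equiv_def by (meson symD)
  show "ind c i k" if "k < n" "ind c i j" "ind c j k"
    using eq rel[of i j] rel[of j k] rel[of i k] that assms unfolding equiv_def by (meson transD)
qed

lemma in_class_iff:
  assumes "c < m" "X \<in> classes c" "ss ! i \<in> X" "j < n"
  shows "ss ! j \<in> X \<longleftrightarrow> ind c i j"
  using Pi_partitionD(3)[OF model _ assms(2,3), of "ss ! j"] assms(1,4) by simp

lemma representative:
  assumes "c < m" "s < n"
  shows "representative c s < n" "ind c s (representative c s)"
proof -
  have "representative c s < n \<and> ind c (representative c s) s"
    unfolding representative_def using assms ind_equiv(1) by (intro last_index_spec) auto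
  then show "representative c s < n" "ind c s (representative c s)"
    using ind_equiv(2) assms by auto
qed

lemma representative_eq:
  assumes "c < m" "s < n" "t < n" "ind c s t"
  shows "representative c s = representative c t"
  unfolding representative_def
proof (rule last_index_cong)
  show "\<exists>j<n. ind c j s" using assms ind_equiv(1) by blast
  show "ind c j s = ind c j t" if "j < n" for j
    using ind_equiv(2,3) assms that by meson
qed

definition labelled :: "(nat \<Rightarrow> nat \<Rightarrow> nat) \<Rightarrow> 's set set \<Rightarrow> bool" where
  "labelled L N \<longleftrightarrow> (\<forall>c<m. (\<forall>i<n. L c i < n \<and> L c (L c i) = L c i \<and> ind c i (L c i)) \<and>
     (\<forall>X\<in>classes c. labels X N (\<lambda>s. L c (position s))))"

lemma labelledD:
  assumes "labelled L N" "c < m"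
  shows "i < n \<Longrightarrow> L c i < n" "i < n \<Longrightarrow> L c (L c i) = L c i" "i < n \<Longrightarrow> ind c i (L c i)"
    and "X \<in> classes c \<Longrightarrow> labels X N (\<lambda>s. L c (position s))"
  using assms by (auto simp: labelled_def)

lemma labelled_init:
  assumes "\<And>c s. c < m \<Longrightarrow> s < n \<Longrightarrow> L c s = s"
  shows "labelled L {}"
  unfolding labelled_def
proof (intro allI impI conjI ballI)
  fix c X assume c: "c < m" and X: "X \<in> classes c"
  have "adj X {} = {}" by (simp add: adj_def)
  then have "labels X {} position"
    using Pi_partition_subset[OF X] position_set
    by (auto simp: labels_def reach_rel_adj subset_iff) metis
  moreover have "L c (position s) = position s" if "s \<in> X" for s
    using assms c position_set Pi_partition_subset[OF X] that by blast
  ultimately show "labels X {} (\<lambda>s. L c (position s))"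
    by (subst labels_cong[of X _ position]) auto
qed (use assms ind_equiv(1) in auto)

lemma labelled_relabelled:
  assumes lab: "labelled L N" and uv: "u < n" "v < n"
  shows "labelled (relabelled u v L) (insert {ss ! u, ss ! v} N)"
  unfolding labelled_def
proof (intro allI impI)
  fix c assume c: "c < m"
  note L = labelledD[OF lab c]
  let ?L = "relabelled u v L"
  have L_u_v: "?L c i = (if ind c u v \<and> L c i = L c u then L c v else L c i)" if "i < n" for i
    using that uv c by (simp add: relabelled_def)
  have same: "ind c i u" if "i < n" "L c i = L c u" for i
  proof -
    have "ind c i (L c u)" using L(3)[OF that(1)] that(2) by simp
    moreover have "ind c (L c u) u" using ind_equiv(2)[OF c] L(1,3) uv by blast
    ultimately show ?thesis using ind_equiv(3)[OF c that(1), of "L c u" u] L(1) uv by blast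
  qed
  have "?L c i < n \<and> ?L c (?L c i) = ?L c i \<and> ind c i (?L c i)" if i: "i < n" for i
  proof (cases "ind c u v \<and> L c i = L c u")
    case True
    have "ind c i v" using ind_equiv(3)[OF c i uv(1,2)] same[OF i] True by blast
    then have "ind c i (L c v)" using ind_equiv(3)[OF c i uv(2), of "L c v"] L(1,3) uv by blast
    then show ?thesis using True i uv L(1,2) by (simp add: L_u_v)
  next
    case False
    then show ?thesis using i L(1,2,3) by (auto simp: L_u_v)
  qed
  moreover have "labels X (insert {ss ! u, ss ! v} N) (\<lambda>s. ?L c (position s))" if X: "X \<in> classes c" for X
  proof -
    let ?f = "\<lambda>s. L c (position s)"
    have pos: "position s < n" "ss ! position s = s" if "s \<in> X" for s
      using Pi_partition_subset[OF X] position_set that by auto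
    show ?thesis
    proof (cases "ss ! u \<in> X \<and> ss ! v \<in> X")
      case True
      then have "ind c u v" using in_class_iff[OF c X _ uv(2)] by blast
      then have "?L c (position s) = (if ?f s = ?f (ss ! u) then ?f (ss ! v) else ?f s)" if "s \<in> X" for s
        using uv pos that by (simp add: L_u_v)
      then show ?thesis
        using labels_relabel[OF L(4)[OF X], of "ss ! u" "ss ! v"] True by (subst labels_cong) auto
    next
      case False
      have "?L c (position s) = ?f s" if s: "s \<in> X" for s
      proof (rule ccontr)
        assume "?L c (position s) \<noteq> ?f s"
        then have uv': "ind c u v" "L c (position s) = L c u"
          using pos[OF s] by (auto simp: L_u_v split: if_splits)
        then have "ind c (position s) u" using same pos[OF s] by blast
        then have "ss ! u \<in> X" using in_class_iff[OF c X, of "position s" u] pos[OF s] s uv by simp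
        moreover from this have "ss ! v \<in> X" using in_class_iff[OF c X _ uv(2)] uv'(1) by blast
        ultimately show False using False by blast
      qed
      then show ?thesis
        using labels_insert_outside[OF L(4)[OF X] False] by (subst labels_cong) auto
    qed
  qed
  ultimately show "(\<forall>i<n. ?L c i < n \<and> ?L c (?L c i) = ?L c i \<and> ind c i (?L c i)) \<and>
      (\<forall>X\<in>classes c. labels X (insert {ss ! u, ss ! v} N) (\<lambda>s. ?L c (position s)))"
    by blast
qed

lemma bad_not_adjacent:
  assumes lab: "labelled L N" and c: "c < m" and s: "s < n" and bad: "bad L representative c s"
  shows "{ss ! s, ss ! representative c s} \<notin> N"
    and "\<exists>X\<in>classes c. \<not> connected_graph X N"
proof -
  let ?r = "representative c s"
  obtain X where X: "X \<in> classes c" "ss ! s \<in> X"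
    using Pi_partition_cover[OF model, of "cs ! c" "ss ! s"] c s by auto
  note r = representative[OF c s]
  have rX: "ss ! ?r \<in> X" using in_class_iff[OF c X r(1)] r(2) by blast
  have "L c (position (ss ! s)) \<noteq> L c (position (ss ! ?r))" using s r(1) bad by (simp add: bad_def)
  then have "(ss ! s, ss ! ?r) \<notin> reach_rel X N"
    using labelledD(4)[OF lab c X(1)] X(2) rX by (auto simp: labels_def)
  then show "{ss ! s, ss ! ?r} \<notin> N" "\<exists>X\<in>classes c. \<not> connected_graph X N"
    using X rX reach_rel_step[of "ss ! s" X "ss ! ?r" N] by (auto simp: connected_graph_def)
qed

definition tree :: "(nat \<Rightarrow> nat \<Rightarrow> nat) \<Rightarrow> nat \<Rightarrow> 's set \<Rightarrow> 's set set" where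
  "tree L c X = (\<lambda>s. {ss ! s, ss ! representative c s}) ` {s. s < n \<and> ss ! s \<in> X \<and> bad L representative c s}"

lemma component_tree_tree:
  assumes lab: "labelled L N" and c: "c < m" and X: "X \<in> classes c"
  shows "component_tree X N (tree L c X)"
proof -
  note L = labelledD[OF lab c]
  have pos: "position s < n" "ss ! position s = s" if "s \<in> X" for s
    using Pi_partition_subset[OF X] position_set that by auto
  have cC: "cs ! c \<in> set cs" using c by simp
  obtain z where z: "z \<in> X" using Pi_partitionD(1)[OF model cC X] by blast
  let ?r = "representative c (position z)"
  let ?f = "\<lambda>s. L c (position s)"
  let ?I = "{s. s < n \<and> ss ! s \<in> X \<and> bad L representative c s}"
  note r = representative[OF c pos(1)[OF z]]
  have rX: "ss ! ?r \<in> X" using in_class_iff[OF c X _ r(1), of "position z"] r(2) pos[OF z] z by simp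
  have rep: "representative c s = ?r" if "s < n" "ss ! s \<in> X" for s
    using representative_eq[OF c that(1) pos(1)[OF z]] in_class_iff[OF c X that(2) pos(1)[OF z]] pos[OF z] z
    by simp
  have "component_tree X N ((\<lambda>s. {s, ss ! ?r}) ` (!) ss ` ?I)"
  proof (rule component_tree_star[where f = ?f])
    show "finite X" using Pi_partitionD(2)[OF model cC X] .
    show "labels X N ?f" using L(4)[OF X] .
    show "inj_on ?f ((!) ss ` ?I)" by (rule inj_onI) (auto simp: bad_def)
    show "?f ` (!) ss ` ?I = ?f ` X - {?f (ss ! ?r)}"
    proof (intro equalityI subsetI)
      fix a assume "a \<in> ?f ` (!) ss ` ?I"
      then obtain s where s: "s < n" "ss ! s \<in> X" "bad L representative c s" "a = ?f (ss ! s)" by blast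
      have "a = s" "L c ?r \<noteq> s" using rep[OF s(1,2)] s by (auto simp: bad_def)
      moreover have "a \<in> ?f ` X" by (rule image_eqI[where x = "ss ! s"]) (use s in auto)
      ultimately show "a \<in> ?f ` X - {?f (ss ! ?r)}" using r(1) by simp
    next
      fix a assume a: "a \<in> ?f ` X - {?f (ss ! ?r)}"
      then obtain x where x: "x \<in> X" "a = L c (position x)" by blast
      have an: "a < n" "L c a = a" using L(1,2) pos(1)[OF x(1)] x(2) by simp_all
      have "ss ! a \<in> X"
        using in_class_iff[OF c X _ an(1), of "position x"] L(3)[of "position x"] pos[OF x(1)] x by simp
      moreover have "bad L representative c a"
        using rep[OF an(1) calculation] an a r(1) by (auto simp: bad_def)
      ultimately have "?f (ss ! a) \<in> ?f ` (!) ss ` ?I" using an(1) by blast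
      then show "a \<in> ?f ` (!) ss ` ?I" using an by simp
    qed
  qed (use rX in auto)
  moreover have "(\<lambda>s. {s, ss ! ?r}) ` (!) ss ` ?I = tree L c X"
    unfolding tree_def image_image by (rule image_cong) (simp_all add: rep)
  ultimately show ?thesis by simp
qed

lemma connected_if_not_bad:
  assumes "labelled L N" "c < m" "\<And>s. s < n \<Longrightarrow> \<not> bad L representative c s" "X \<in> classes c"
  shows "connected_graph X N"
proof -
  have "tree L c X = {}" using assms(3) by (auto simp: tree_def)
  then show ?thesis using component_tree_tree[OF assms(1,2,4)] by (simp add: component_tree_def)
qed

lemma step_tree:
  assumes lab: "labelled L (edges Q)"
    and Q': "Q' = Q \<union> {(s, representative c s) | c s. c < m \<and> s < n \<and> K = card (cs ! c) \<and>
      bad L representative c s}"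
  shows "step (int K, edges Q) (int K - 1, edges Q')"
proof -
  define index where "index = the_inv_into {..<m} ((!) cs)"
  have index: "index (cs ! c) = c" if "c < m" for c
    unfolding index_def using distinct(2) that by (intro the_inv_into_f_f inj_on_nth) auto
  have cover: "\<exists>X\<in>classes c. ss ! s \<in> X" if "c < m" "s < n" for c s
    using Pi_partition_cover[OF model, of "cs ! c" "ss ! s"] that by auto
  show ?thesis
  proof (rule snac_step.intros[where T = "\<lambda>c. tree L (index c)"])
    show "\<forall>c\<in>set cs. int (card c) = int K \<longrightarrow> (\<forall>X\<in>Pi_partition (set ss) \<Psi> c.
        component_tree X (edges Q) (tree L (index c) X))"
      using component_tree_tree[OF lab] index by (auto simp: in_set_conv_nth)
    have "edges {(s, representative c s) | c s. c < m \<and> s < n \<and> K = card (cs ! c) \<and> bad L representative c s}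
      = (\<Union>c\<in>{c. c < m \<and> card (cs ! c) = K}. \<Union>X\<in>classes c. tree L c X)"
      (is "?l = ?r")
    proof (intro equalityI subsetI)
      fix e assume "e \<in> ?l"
      then obtain c s where cs: "c < m" "s < n" "K = card (cs ! c)" "bad L representative c s"
          "e = {ss ! s, ss ! representative c s}" by blast
      obtain X where "X \<in> classes c" "ss ! s \<in> X" using cover[OF cs(1,2)] by blast
      then show "e \<in> ?r" using cs by (auto simp: tree_def)
    next
      fix e assume "e \<in> ?r"
      then obtain c X s where "c < m" "s < n" "K = card (cs ! c)" "bad L representative c s"
          "e = {ss ! s, ss ! representative c s}" by (auto simp: tree_def)
      then show "e \<in> ?l" by (intro image_eqI[where x = "(s, representative c s)"]) auto
    qed
    also have "\<dots> = (\<Union>c\<in>{c\<in>set cs. int (card c) = int K}. \<Union>X\<in>Pi_partition (set ss) \<Psi> c. tree L (index c) X)"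
    proof -
      have "{c\<in>set cs. int (card c) = int K} = (!) cs ` {c. c < m \<and> card (cs ! c) = K}"
        by (auto simp: in_set_conv_nth)
      then show ?thesis by (simp add: index)
    qed
    finally show "edges Q' = edges Q \<union>
        (\<Union>c\<in>{c\<in>set cs. int (card c) = int K}. \<Union>X\<in>Pi_partition (set ss) \<Psi> c. tree L (index c) X)"
      by (simp only: Q' image_Un)
  qed simp
qed

definition selected :: "store \<Rightarrow> bool" where
  "selected \<sigma> \<longleftrightarrow>
     (\<forall>c<m. \<forall>s<n. bad (\<sigma> 8) representative c s \<longrightarrow> card (cs ! c) < \<sigma> 3 0 0) \<and>
     (\<sigma> 3 0 0 \<noteq> 0 \<longrightarrow>
       (\<exists>c<m. \<exists>s<n. bad (\<sigma> 8) representative c s \<and> \<sigma> 3 0 0 = Suc (card (cs ! c))))"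

definition marked :: "store \<Rightarrow> (nat \<times> nat) set \<Rightarrow> bool" where
  "marked \<sigma> Q \<longleftrightarrow> Q \<subseteq> {..<n} \<times> {..<n} \<and> (\<forall>x y. \<sigma> 10 x y = 0 \<longleftrightarrow> (x, y) \<notin> Q) \<and>
     (\<forall>c<m. \<forall>s<n. \<sigma> 9 c s = representative c s) \<and> labelled (\<sigma> 8) (edges Q)"

definition reached :: "(nat \<times> nat) set \<Rightarrow> bool" where
  "reached Q \<longleftrightarrow> (\<exists>k\<ge>-1. step\<^sup>*\<^sup>* start (k, edges Q))"

lemma bad_cong:
  "\<lbrakk> \<forall>c<m. \<forall>s<n. R c s = representative c s; c < m; s < n \<rbrakk> \<Longrightarrow>
    bad L R c s \<longleftrightarrow> bad L representative c s"
  by (simp add: bad_def)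

lemma runs_select_marked:
  assumes "marked \<sigma> Q"
  shows "runs ss cs \<Psi> select_prog \<sigma> Q (\<lambda>t \<sigma>' Q'. t \<le> 200 * (n + 1) * (m + 1) \<and> Q' = Q \<and>
    marked \<sigma>' Q \<and> selected \<sigma>')"
proof -
  have R: "\<forall>c<m. \<forall>s<n. \<sigma> 9 c s = representative c s" using assms by (simp add: marked_def)
  show ?thesis
    using runs_select[of \<sigma> Q]
  proof (rule runs_mono, goal_cases)
    case (1 t \<sigma>' Q')
    then have eq: "\<sigma>' 8 = \<sigma> 8" "\<sigma>' 9 = \<sigma> 9" "\<sigma>' 10 = \<sigma> 10" by simp_all
    have "selected \<sigma>'"
      unfolding selected_def eq using 1 bad_cong[OF R, of _ _ "\<sigma> 8"] by metis
    moreover have "marked \<sigma>' Q" using assms by (simp add: marked_def eq)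
    ultimately show ?case using 1 by blast
  qed
qed

lemma reached_step:
  assumes mk: "marked \<sigma> Q" and sel: "selected \<sigma>" and reached: "reached Q" and K: "\<sigma> 3 0 0 = Suc K"
    and Q': "Q' = Q \<union> {(s, representative c s) | c s. c < m \<and> s < n \<and> K = card (cs ! c) \<and>
      bad (\<sigma> 8) representative c s}"
  shows "reached Q'" and "\<not> Q' \<subseteq> Q"
proof -
  have lab: "labelled (\<sigma> 8) (edges Q)" using mk by (simp add: marked_def)
  obtain k where k: "k \<ge> -1" "step\<^sup>*\<^sup>* start (k, edges Q)" using reached by (auto simp: reached_def)
  obtain c s where c: "c < m" "s < n" "bad (\<sigma> 8) representative c s" "K = card (cs ! c)"
    using sel K unfolding selected_def by auto
  note na = bad_not_adjacent[OF lab c(1-3)]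
  have "int K \<le> k"
    using snac_reachable_invariant[OF model k(2)] na(2) c(1,4) by (meson not_le nth_mem)
  have "step\<^sup>*\<^sup>* (k, edges Q) (int K, edges Q)"
  proof (rule snac_skip[OF model])
    fix d X assume d: "d \<in> set cs" "int K < int (card d)" "X \<in> Pi_partition (set ss) \<Psi> d"
    then obtain i where i: "i < m" "d = cs ! i" by (auto simp: in_set_conv_nth)
    have "\<not> bad (\<sigma> 8) representative i t" if "t < n" for t
      using sel K d(2) i that unfolding selected_def by force
    then show "connected_graph X (edges Q)"
      using connected_if_not_bad[OF lab i(1)] d(3) i(2) by blast
  qed (use \<open>int K \<le> k\<close> in auto)
  moreover have "step (int K, edges Q) (int K - 1, edges Q')" using lab Q' by (rule step_tree)
  ultimately have "step\<^sup>*\<^sup>* start (int K - 1, edges Q')"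
    using k(2) by (meson rtranclp.rtrancl_into_rtrancl rtranclp_trans)
  then show "reached Q'" unfolding reached_def by (intro exI[of _ "int K - 1"]) simp
  have "(s, representative c s) \<in> Q'" using Q' c by blast
  moreover have "(s, representative c s) \<notin> Q" using na(1) by force
  ultimately show "\<not> Q' \<subseteq> Q" by blast
qed

lemma output_if_selected_none:
  assumes "marked \<sigma> Q" "selected \<sigma>" "reached Q" "\<sigma> 3 0 0 = 0"
  shows "snac_output (set ss) (set cs) \<Psi> (edges Q)"
proof -
  obtain k where k: "k \<ge> -1" "step\<^sup>*\<^sup>* start (k, edges Q)" using assms(3) by (auto simp: reached_def)
  have "step\<^sup>*\<^sup>* (k, edges Q) (-1, edges Q)"
  proof (rule snac_skip[OF model])
    fix d X assume d: "d \<in> set cs" "X \<in> Pi_partition (set ss) \<Psi> d"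
    then obtain i where i: "i < m" "d = cs ! i" by (auto simp: in_set_conv_nth)
    show "connected_graph X (edges Q)"
      using connected_if_not_bad[OF _ i(1)] assms d(2) i unfolding marked_def selected_def by fastforce
  qed (use k in auto)
  then show ?thesis
    unfolding snac_output_def using k(2) by (intro exI[of _ "-1"]) (auto intro: rtranclp_trans)
qed

lemma card_marked: "marked \<sigma> Q \<Longrightarrow> card Q \<le> n ^ 2"
  using card_mono[of "{..<n} \<times> {..<n}" Q] by (simp add: marked_def power2_eq_square)

lemma runs_iteration:
  assumes mk: "marked \<sigma> Q" and sel: "selected \<sigma>" and reached: "reached Q" and nz: "\<sigma> 3 0 0 \<noteq> 0"
  shows "runs ss cs \<Psi> (Seq collect_prog (Seq merge_prog select_prog)) \<sigma> Q (\<lambda>t \<sigma>' Q'.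
    marked \<sigma>' Q' \<and> selected \<sigma>' \<and> reached Q' \<and> card Q < card Q' \<and>
    10 + t \<le> 1500 * (n + 1) * (m + 1) * (card Q' - card Q))"
proof -
  obtain K where K: "\<sigma> 3 0 0 = Suc K" using nz by (cases "\<sigma> 3 0 0") auto
  have mkD: "Q \<subseteq> {..<n} \<times> {..<n}" "\<And>x y. \<sigma> 10 x y = 0 \<longleftrightarrow> (x, y) \<notin> Q"
      "\<And>c s. c < m \<Longrightarrow> s < n \<Longrightarrow> \<sigma> 9 c s = representative c s" "labelled (\<sigma> 8) (edges Q)"
    using mk by (simp_all add: marked_def)
  have R: "\<sigma> 9 c s < n" if "c < m" "s < n" for c s
    using mkD(3) representative(1) that by simp
  show ?thesis
  proof (rule runs_Seq, rule runs_mono, rule runs_collect[of \<sigma> "Suc K" Q], goal_cases)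
    case (5 t1 \<sigma>1 Q1)
    then have frame1: "\<forall>x\<in>{3,8,9}. \<sigma>1 x = \<sigma> x"
      and sub1: "Q1 \<subseteq> {..<n} \<times> {..<n}" and mark1: "\<forall>x y. \<sigma>1 10 x y = 0 \<longleftrightarrow> (x, y) \<notin> Q1"
      and list: "Q1 = Q \<union> (\<lambda>i. (\<sigma>1 11 i 0, \<sigma>1 11 i 1)) ` {..<\<sigma>1 4 0 0}"
      and card1: "card Q1 = card Q + \<sigma>1 4 0 0" and t1: "t1 \<le> 200 * (n + 1) * (m + 1)"
      and Q1: "Q1 = Q \<union> {(s, \<sigma> 9 c s) | c s. c < m \<and> s < n \<and> Suc K = Suc (card (cs ! c)) \<and>
        bad (\<sigma> 8) (\<sigma> 9) c s}"
      by - ((elim conjE, assumption)+)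
    have \<sigma>1: "\<sigma>1 8 = \<sigma> 8" "\<sigma>1 9 = \<sigma> 9" using frame1 by simp_all
    have Q1': "Q1 = Q \<union> {(s, representative c s) | c s. c < m \<and> s < n \<and> K = card (cs ! c) \<and>
        bad (\<sigma> 8) representative c s}"
      unfolding Q1 using mkD(3) bad_cong[of "\<sigma> 9" _ _ "\<sigma> 8"]
      by (intro arg_cong2[of _ _ _ _ "(\<union>)"] refl Collect_cong iff_exI) auto
    note reached1 = reached_step[OF mk sel reached K Q1']
    have pos: "\<sigma>1 4 0 0 > 0" using list reached1(2) by (cases "\<sigma>1 4 0 0") auto
    let ?J = "\<lambda>i L. labelled L (edges Q \<union> (\<lambda>j. {ss ! (\<sigma>1 11 j 0), ss ! (\<sigma>1 11 j 1)}) ` {..<i})"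
    have J: "?J (Suc i) (relabelled (\<sigma>1 11 i 0) (\<sigma>1 11 i 1) L)" if "i < \<sigma>1 4 0 0" "?J i L" for i L
    proof -
      have "(\<sigma>1 11 i 0, \<sigma>1 11 i 1) \<in> {..<n} \<times> {..<n}" using sub1 that(1) unfolding list by blast
      then show ?thesis
        using labelled_relabelled[OF that(2)] by (simp add: lessThan_Suc)
    qed
    have edges1: "edges Q1 = edges Q \<union> (\<lambda>j. {ss ! (\<sigma>1 11 j 0), ss ! (\<sigma>1 11 j 1)}) ` {..<\<sigma>1 4 0 0}"
      by (subst list) (simp add: image_Un image_image)
    have J0: "?J 0 (\<sigma>1 8)" using mkD(4) \<sigma>1 by simp
    show ?case
    proof (rule runs_Seq, rule runs_mono, rule runs_merge[of \<sigma>1 ?J Q1], goal_cases)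
      case (3 t2 \<sigma>2 Q2)
      then have Q2: "Q2 = Q1" and t2: "t2 \<le> 300 * (n + 1) * (m + 1) * (\<sigma>1 4 0 0 + 1)"
        and \<sigma>2: "\<sigma>2 9 = \<sigma>1 9" "\<sigma>2 10 = \<sigma>1 10" and lab2: "labelled (\<sigma>2 8) (edges Q1)"
        unfolding edges1 by simp_all
      have "marked \<sigma>2 Q1"
        using sub1 mark1 lab2 mkD(3) by (simp add: marked_def \<sigma>1 \<sigma>2)
      from runs_select_marked[OF this] show ?case
        unfolding Q2
      proof (rule runs_mono, goal_cases)
        case (1 t3 \<sigma>3 Q3)
        let ?X = "(n + 1) * (m + 1)"
        have "?X * 1 \<le> ?X * \<sigma>1 4 0 0" "1 \<le> ?X" using pos by (intro mult_le_mono2) simp_all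
        moreover have "t1 \<le> 200 * ?X" "t2 \<le> 300 * (?X * \<sigma>1 4 0 0) + 300 * ?X" "t3 \<le> 200 * ?X"
          using t1 t2 1 by (simp_all add: algebra_simps)
        ultimately have "10 + (1 + t1 + (1 + t2 + t3)) \<le> 1500 * (?X * \<sigma>1 4 0 0)" by linarith
        also have "\<dots> = 1500 * (n + 1) * (m + 1) * (card Q1 - card Q)"
          by (simp add: card1 algebra_simps)
        finally show ?case using 1 reached1(1) pos by (auto simp: card1)
      qed
    qed (use J J0 in auto)
  qed (use K mkD R in auto)
qed

lemma runs_snac_prog:
  "runs ss cs \<Psi> snac_prog (\<lambda>_ _ _. 0) {} (\<lambda>t \<sigma> Q. t \<le> 3000 * (m + 1) * (n + 1) ^ 3 \<and>
    snac_output (set ss) (set cs) \<Psi> (edges Q))"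
  unfolding snac_prog_def
proof (rule runs_Seq, rule runs_mono[OF runs_init], goal_cases)
  case (1 t1 \<sigma>1 Q1)
  then have Q1: "Q1 = {}" and t1: "t1 \<le> 200 * (n + 1) ^ 2 * (m + 1)" by blast+
  have mk1: "marked \<sigma>1 {}"
    using 1 labelled_init[of "\<sigma>1 8"] by (simp add: marked_def)
  show ?case
    unfolding Q1
  proof (rule runs_Seq, rule runs_mono[OF runs_select_marked[OF mk1]], goal_cases)
    case (1 t2 \<sigma>2 Q2)
    then have Q2: "Q2 = {}" and t2: "t2 \<le> 200 * (n + 1) * (m + 1)"
      and mk2: "marked \<sigma>2 {}" and sel2: "selected \<sigma>2" by blast+
    have reached2: "reached {}"
      unfolding reached_def snac_init_def by (intro exI[of _ "int (Max (card ` set cs))"]) simp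
    show ?case
      unfolding Q2
    proof (rule runs_While[where I = "\<lambda>\<sigma> Q. marked \<sigma> Q \<and> selected \<sigma> \<and> reached Q"
          and \<phi> = "\<lambda>\<sigma> Q. n ^ 2 - card Q" and W = "1500 * (n + 1) * (m + 1)"], goal_cases)
      case (1 \<sigma> Q)
      then have nz: "\<sigma> 3 0 0 \<noteq> 0" by simp
      show ?case
      proof (rule runs_mono[OF runs_iteration[of \<sigma> Q, OF _ _ _ nz]], goal_cases)
        case (4 t \<sigma>' Q')
        then have "card Q' \<le> n ^ 2" using card_marked by blast
        then have "n ^ 2 - card Q - (n ^ 2 - card Q') = card Q' - card Q" "n ^ 2 - card Q' < n ^ 2 - card Q"
          using 4 by auto
        then show ?case using 4 by simp
      qed (use 1 in auto)
    next
      case 2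
      then show ?case using mk2 sel2 reached2 by simp
    next
      case (3 t3 \<sigma>3 Q3)
      let ?X = "(m + 1) * (n + 1) ^ 3"
      have "(n + 1) ^ 2 \<le> (n + 1) ^ 3" by (rule power_increasing) simp_all
      moreover have "n + 1 \<le> (n + 1) ^ 3" using power_increasing[of 1 3 "n + 1"] by simp
      moreover have "n ^ 2 \<le> (n + 1) ^ 2" by (rule power_mono) simp_all
      then have "(n + 1) * n ^ 2 \<le> (n + 1) ^ 3"
        using mult_le_mono2[of "n ^ 2" _ "n + 1"] by (simp only: power3_eq_cube power2_eq_square mult.assoc)
      ultimately have "(m + 1) * (n + 1) ^ 2 \<le> ?X" "(m + 1) * ((n + 1) * n ^ 2) \<le> ?X"
        "(m + 1) * (n + 1) \<le> ?X"
        by (simp_all only: mult_le_mono2)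
      moreover have "1 \<le> ?X" unfolding Suc_le_eq One_nat_def by simp
      moreover have "t1 \<le> 200 * ((m + 1) * (n + 1) ^ 2)" "t2 \<le> 200 * ((m + 1) * (n + 1))"
        "t3 \<le> 4 + 1500 * ((m + 1) * ((n + 1) * n ^ 2))"
        using t1 t2 3(3) by (simp_all add: algebra_simps)
      ultimately have "1 + t1 + (1 + t2 + t3) \<le> 3000 * ?X" by linarith
      moreover have "snac_output (set ss) (set cs) \<Psi> (edges Q3)"
        using 3(1,2) by (intro output_if_selected_none[of \<sigma>3]) simp_all
      ultimately show ?case by (simp only: mult.assoc)
    qed
  qed
qed

end

definition snac_time :: "nat \<Rightarrow> nat \<Rightarrow> nat" where
  "snac_time m n = 3000 * (m + 1) * (n + 1) ^ 3"

lemma implements_snac: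
  assumes "scenario_model E S C \<Psi>" "set ss = S" "distinct ss" "set cs = C" "distinct cs"
  shows "implements_snac_within snac_prog (snac_time (card C) (card S)) ss cs \<Psi>"
proof -
  interpret snac_instance ss cs \<Psi> E
    using assms by unfold_locales simp_all
  have "card C = length cs" "card S = length ss"
    using assms distinct_card by auto
  then show ?thesis
    using runs_snac_prog assms
    unfolding runs_def implements_snac_within_def snac_time_def by auto
qed

lemma snac_time_bigo:
  "(\<lambda>(m, n). real (snac_time m n)) \<in> O[at_top \<times>\<^sub>F at_top](\<lambda>(m, n). real m * real n ^ 3)"
proof (rule bigoI[where c = 48000])
  have "eventually (\<lambda>x. (1 :: nat) \<le> fst x \<and> (1 :: nat) \<le> snd x) (at_top \<times>\<^sub>F at_top)"
    unfolding eventually_prod_filter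
    by (intro exI[of _ "\<lambda>m. 1 \<le> m"] conjI) (simp_all add: eventually_ge_at_top)
  then show "\<forall>\<^sub>F x in at_top \<times>\<^sub>F at_top. norm (case x of (m, n) \<Rightarrow> real (snac_time m n))
      \<le> 48000 * norm (case x of (m, n) \<Rightarrow> real m * real n ^ 3)"
  proof eventually_elim
    case (elim x)
    obtain m n where x: "x = (m, n)" by fastforce
    have "n + 1 \<le> 2 * n" "m + 1 \<le> 2 * m" using elim x by auto
    then have "(n + 1) ^ 3 \<le> (2 * n) ^ 3" "m + 1 \<le> 2 * m" using power_mono by blast+
    then have "(m + 1) * (n + 1) ^ 3 \<le> 2 * m * (2 * n) ^ 3" by (rule mult_le_mono[rotated])
    then have "snac_time m n \<le> 48000 * (m * n ^ 3)"
      unfolding snac_time_def by (simp only: power_mult_distrib mult.assoc) simp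
    then have "real (snac_time m n) \<le> real (48000 * (m * n ^ 3))" by (rule of_nat_mono)
    then show ?case using x by simp
  qed
qed

theorem theorem3:
  fixes V :: "'v set"
  assumes "\<exists>a\<in>V. \<exists>b\<in>V. a \<noteq> b"
  shows
    "(\<forall>(E :: 'e set) (S :: 's set) C \<Psi>. scenario_model E S C \<Psi> \<longrightarrow>
        snac_terminates S C \<Psi> \<and>
        (\<forall>N. snac_output S C \<Psi> N \<longrightarrow> sufficient V S C \<Psi> N) \<and>
        (\<exists>N. snac_output S C \<Psi> N \<and> minimum_sufficient V S C \<Psi> N) \<and>
        (jointly_permissible S C \<Psi> \<longrightarrow>
           (\<forall>N. snac_output S C \<Psi> N \<longrightarrow> minimum_sufficient V S C \<Psi> N))) \<and>
     (\<exists>(p :: com) (T :: nat \<Rightarrow> nat \<Rightarrow> nat).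
        (\<forall>(E :: 'e set) (S :: 's set) C \<Psi> ss cs.
           scenario_model E S C \<Psi> \<and> set ss = S \<and> distinct ss \<and> set cs = C \<and> distinct cs \<longrightarrow>
           implements_snac_within p (T (card C) (card S)) ss cs \<Psi>) \<and>
        (\<lambda>(m, n). real (T m n)) \<in>
          O[at_top \<times>\<^sub>F at_top](\<lambda>(m, n). real m * real n ^ 3))"
proof (intro conjI exI[of _ snac_prog] exI[of _ snac_time] allI impI)
  fix E :: "'e set" and S :: "'s set" and C \<Psi>
  assume model: "scenario_model E S C \<Psi>"
  show "snac_terminates S C \<Psi>" using model by (rule snac_terminates)
  show "sufficient V S C \<Psi> N" if "snac_output S C \<Psi> N" for N
    using assms model that by (rule snac_output_sufficient)
  show "\<exists>N. snac_output S C \<Psi> N \<and> minimum_sufficient V S C \<Psi> N"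
    using assms model by (rule minimum_output_exists)
  show "minimum_sufficient V S C \<Psi> N" if "jointly_permissible S C \<Psi>" "snac_output S C \<Psi> N" for N
    using assms model that by (rule output_minimum)
next
  fix E :: "'e set" and S :: "'s set" and C \<Psi> ss cs
  assume "scenario_model E S C \<Psi> \<and> set ss = S \<and> distinct ss \<and> set cs = C \<and> distinct cs"
  then show "implements_snac_within snac_prog (snac_time (card C) (card S)) ss cs \<Psi>"
    using implements_snac by blast
qed (rule snac_time_bigo)

end
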